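(* Let $v$ be a positive integer such that every maximal prime-power factor of $v$ (i.e. every $p^{a}$ with $p$ prime, $p^a\mid v$, $p^{a+1}\nmid v$, $a\ge1$) is a prime power congruent to $1 \pmod 6$ and different from $13$. Then there exists a regular Fano Kaleidoscope FK$(v)$.
   Context: A Fano Kaleidoscope of order $v$, FK$(v)$, is a set $\mathcal F$ of Fano planes (2-$(7,3,1)$ designs) whose points lie in a $v$-set $\mathcal V$, the seven lines of each plane colored with seven distinct colors $c_0,\dots,c_6$, such that for any two distinct points $x,y\in\mathcal V$ and any color $c_i$ there is exactly one plane of $\mathcal F$ whose $c_i$-colored line contains $x$ and $y$. It is regular if there is a group $G$ of order $v$ acting sharply transitively on $\mathcal V$ (so $\mathcal V$ is identified with $G$) such that the collection of colored planes is invariant under translations by $G$. *)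

theory Defs
  imports "HOL-Algebra.Group_Action" "HOL-Library.Numeral_Type" "HOL-Number_Theory.Cong"
    "HOL-Computational_Algebra.Primes"
begin

definition two_design :: "nat \<Rightarrow> nat \<Rightarrow> nat \<Rightarrow> 'a set \<Rightarrow> 'a set set \<Rightarrow> bool" where
  "two_design n k l P B \<longleftrightarrow>
     finite P \<and> card P = n \<and>
     (\<forall>b\<in>B. b \<subseteq> P \<and> card b = k) \<and>
     (\<forall>x\<in>P. \<forall>y\<in>P. x \<noteq> y \<longrightarrow> card {b \<in> B. x \<in> b \<and> y \<in> b} = l)"

text \<open>
  The colors \<open>c\<^sub>0, \<dots>, c\<^sub>6\<close> are the elements of the seven-element type \<open>7\<close>;
  \<open>cline A c\<close> is the line of \<open>A\<close> whose color is \<open>c\<close>. Thus two colorings of the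
  same plane are different colored planes.
\<close>

record 'a colored_plane =
  points :: "'a set"
  cline :: "7 \<Rightarrow> 'a set"

definition colored_fano_plane :: "'a colored_plane \<Rightarrow> bool" where
  "colored_fano_plane A \<longleftrightarrow>
     two_design 7 3 1 (points A) (range (cline A)) \<and> inj (cline A)"

definition fano_kaleidoscope :: "nat \<Rightarrow> 'a set \<Rightarrow> 'a colored_plane set \<Rightarrow> bool" where
  "fano_kaleidoscope v V F \<longleftrightarrow>
     finite V \<and> card V = v \<and>
     (\<forall>A\<in>F. colored_fano_plane A \<and> points A \<subseteq> V) \<and>
     (\<forall>x\<in>V. \<forall>y\<in>V. x \<noteq> y \<longrightarrow> (\<forall>c. \<exists>!A. A \<in> F \<and> x \<in> cline A c \<and> y \<in> cline A c))"

definition map_plane :: "('a \<Rightarrow> 'b) \<Rightarrow> 'a colored_plane \<Rightarrow> 'b colored_plane" where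
  "map_plane f A = \<lparr>points = f ` points A, cline = (\<lambda>c. f ` cline A c)\<rparr>"

definition sharply_transitive_action ::
    "('g, 'm) monoid_scheme \<Rightarrow> 'a set \<Rightarrow> ('g \<Rightarrow> 'a \<Rightarrow> 'a) \<Rightarrow> bool" where
  "sharply_transitive_action G V \<phi> \<longleftrightarrow>
     group_action G V \<phi> \<and> (\<forall>x\<in>V. \<forall>y\<in>V. \<exists>!g. g \<in> carrier G \<and> \<phi> g x = y)"

text \<open>
  A group acting sharply transitively on \<open>V\<close> has as many elements as \<open>V\<close>, so taking
  its elements from the type of the points is no restriction.
\<close>

definition regular_fano_kaleidoscope :: "nat \<Rightarrow> 'a set \<Rightarrow> 'a colored_plane set \<Rightarrow> bool" where
  "regular_fano_kaleidoscope v V F \<longleftrightarrow>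
     fano_kaleidoscope v V F \<and>
     (\<exists>(G :: 'a monoid) \<phi>.
        group G \<and> order G = v \<and> sharply_transitive_action G V \<phi> \<and>
        (\<forall>g\<in>carrier G. map_plane (\<phi> g) ` F = F))"

end

theory Submission
  imports Defs "HOL-Analysis.Convex" "HOL-Number_Theory.Residues"
begin

text \<open>
  Let \<open>R\<close> be a finite field with \<open>q \<equiv> 1 (mod 6)\<close> elements. Suppose that seven points of \<open>R\<close>, labelled by the
  points of a Fano plane, are such that on every line the three differences lie in three different
  cosets of the group of cubes. Since \<open>-1\<close> is a cube, multiplying the plane by representatives of the
  cubes modulo \<open>\<plusminus>1\<close> yields base planes in which, for every colour, every nonzero element of \<open>R\<close> occurs
  exactly once as a difference; their translates form a regular Fano Kaleidoscope on \<open>(R, +)\<close>.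
  Such difference families over a group \<open>G\<close> and over \<open>R\<close> combine to one over \<open>G \<times> R\<close>: spread the base
  planes of \<open>G\<close> out by seven distinct multipliers from \<open>R\<close>. Hence it is enough to treat the fields with
  \<open>p\<close> elements (\<open>p \<equiv> 1 (mod 6)\<close>, \<open>p \<noteq> 13\<close>), with \<open>p\<^sup>2\<close> elements (\<open>p \<equiv> 5 (mod 6)\<close>), and with \<open>13\<^sup>2\<close> and \<open>13\<^sup>3\<close>
  elements.

  For \<open>q \<ge> 74\<^sup>2\<close> the seven points exist because colouring pairs of field elements by the cubic class of
  their difference is quasirandom: a cubic character has constant autocorrelation, which bounds its
  bilinear sums by \<open>\<surd>q\<close>, and the affine group acts two-transitively, which gives the exact second moment
  of the number of points completing two given pairs to rainbow triples. For smaller \<open>q\<close> explicit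
  points are checked.
\<close>

section \<open>Rainbow Fano planes\<close>

definition rainbow :: "('a \<Rightarrow> 'a \<Rightarrow> 'b) \<Rightarrow> 'a \<Rightarrow> 'a \<Rightarrow> 'a \<Rightarrow> bool" where
  "rainbow f x y z \<longleftrightarrow> distinct [x, y, z] \<and> distinct [f x y, f y z, f x z]"

definition fano_line :: "7 \<Rightarrow> 7 set" where
  "fano_line c = {c, c + 1, c + 3}"

definition rainbow_fano :: "('a \<Rightarrow> 'a \<Rightarrow> 'b) \<Rightarrow> (7 \<Rightarrow> 'a) \<Rightarrow> bool" where
  "rainbow_fano f P \<longleftrightarrow> (\<forall>c. rainbow f (P c) (P (c + 1)) (P (c + 3)))"

definition has_rainbow_fano :: "'a set \<Rightarrow> ('a \<Rightarrow> 'a \<Rightarrow> 'b) \<Rightarrow> bool" where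
  "has_rainbow_fano K f \<longleftrightarrow> (\<exists>P. range P \<subseteq> K \<and> rainbow_fano f P)"

lemma UNIV_7: "(UNIV :: 7 set) = {0, 1, 2, 3, 4, 5, 6}"
proof -
  have "c \<in> {0, 1, 2, 3, 4, 5, 6}" for c :: 7
  proof (cases c)
    case (of_int z)
    then have "z \<in> {0, 1, 2, 3, 4, 5, 6}" by auto
    then show ?thesis using of_int(1) by auto
  qed
  then show ?thesis by blast
qed

lemma all_7_iff: "(\<forall>c::7. P c) \<longleftrightarrow> P 0 \<and> P 1 \<and> P 2 \<and> P 3 \<and> P 4 \<and> P 5 \<and> P 6"
proof -
  have "(\<forall>c. P c) \<longleftrightarrow> (\<forall>c\<in>(UNIV :: 7 set). P c)" by simp
  then show ?thesis unfolding UNIV_7 by simp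
qed

lemma card_fano_line: "card (fano_line c) = 3"
  unfolding fano_line_def by simp

lemma fano_line_through:
  assumes "i \<noteq> j"
  shows "\<exists>!c. i \<in> fano_line c \<and> j \<in> fano_line c"
proof -
  have "\<forall>i j. i \<noteq> j \<longrightarrow> (\<exists>c. i \<in> fano_line c \<and> j \<in> fano_line c \<and>
      (\<forall>c'. i \<in> fano_line c' \<and> j \<in> fano_line c' \<longrightarrow> c' = c))"
    unfolding all_7_iff fano_line_def not_all[symmetric] by (simp add: not_all[symmetric])
  then show ?thesis using assms by blast
qed

lemma inj_fano_line: "inj fano_line"
proof (rule injI)
  fix c c' assume "fano_line c = fano_line c'"
  moreover have "c \<noteq> c + 1" "c \<in> fano_line c" "c + 1 \<in> fano_line c"
    by (auto simp: fano_line_def)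
  ultimately show "c = c'" using fano_line_through[of c "c + 1"] by auto
qed

lemma has_rainbow_fanoI:
  assumes "{a0, a1, a2, a3, a4, a5, a6} \<subseteq> K"
    and "rainbow f a0 a1 a3" "rainbow f a1 a2 a4" "rainbow f a2 a3 a5" "rainbow f a3 a4 a6"
      "rainbow f a4 a5 a0" "rainbow f a5 a6 a1" "rainbow f a6 a0 a2"
  shows "has_rainbow_fano K f"
proof -
  define P :: "7 \<Rightarrow> 'a" where
    "P i = (if i = 0 then a0 else if i = 1 then a1 else if i = 2 then a2 else if i = 3 then a3
       else if i = 4 then a4 else if i = 5 then a5 else a6)" for i
  have P_values: "P 0 = a0" "P 1 = a1" "P 2 = a2" "P 3 = a3" "P 4 = a4" "P 5 = a5" "P 6 = a6"
    by (simp_all add: P_def)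
  have wrap: "(7::7) = 0" "(8::7) = 1" "(9::7) = 2" by simp_all
  have "rainbow_fano f P"
    unfolding rainbow_fano_def all_7_iff using assms(2-) by (simp add: P_values wrap)
  moreover have "range P \<subseteq> K" unfolding UNIV_7 using assms(1) by (simp add: P_values)
  ultimately show ?thesis unfolding has_rainbow_fano_def by blast
qed

lemma rainbow_fano_inj:
  assumes "rainbow_fano f P"
  shows "inj P"
proof (rule injI, rule ccontr)
  fix i j assume "P i = P j" "i \<noteq> j"
  then obtain c where "i \<in> fano_line c" "j \<in> fano_line c" using fano_line_through by blast
  moreover have "distinct [P c, P (c + 1), P (c + 3)]"
    using assms by (simp add: rainbow_fano_def rainbow_def)
  ultimately show False using \<open>P i = P j\<close> \<open>i \<noteq> j\<close> unfolding fano_line_def by fastforce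
qed

lemma rainbow_fano_pair_unique:
  assumes "rainbow_fano f P" and sym: "\<And>i j. f (P i) (P j) = f (P j) (P i)"
    and "i \<in> fano_line c" "j \<in> fano_line c" "i \<noteq> j"
    and "i' \<in> fano_line c" "j' \<in> fano_line c" "i' \<noteq> j'"
    and "f (P i) (P j) = f (P i') (P j')"
  shows "i' = i \<and> j' = j \<or> i' = j \<and> j' = i"
proof -
  have "distinct [f (P c) (P (c + 1)), f (P (c + 1)) (P (c + 3)), f (P c) (P (c + 3))]"
    using assms(1) by (simp add: rainbow_fano_def rainbow_def)
  moreover note sym[of "c + 1" c] sym[of "c + 3" c] sym[of "c + 3" "c + 1"]
  ultimately show ?thesis
    using assms(3-9) unfolding fano_line_def by (elim insertE emptyE; simp)
qed

section \<open>Fano difference families\<close>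

definition fano_plane :: "(7 \<Rightarrow> 'a) \<Rightarrow> 'a colored_plane" where
  "fano_plane P = \<lparr>points = range P, cline = \<lambda>c. P ` fano_line c\<rparr>"

lemma map_plane_fano_plane: "map_plane f (fano_plane P) = fano_plane (f \<circ> P)"
  by (simp add: map_plane_def fano_plane_def image_comp comp_def)

lemma colored_fano_plane_fano_plane:
  assumes "inj P"
  shows "colored_fano_plane (fano_plane P)"
proof -
  note mem = inj_image_mem_iff[OF assms]
  have lines_through: "is_singleton {b \<in> range (\<lambda>c. P ` fano_line c). P i \<in> b \<and> P j \<in> b}" if neq: "P i \<noteq> P j" for i j
  proof -
    obtain c where "\<And>c'. i \<in> fano_line c' \<and> j \<in> fano_line c' \<longleftrightarrow> c' = c"
      using fano_line_through[of i j] neq by metis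
    then show ?thesis by (simp add: Compr_image_eq mem)
  qed
  have "two_design 7 3 1 (range P) (range (\<lambda>c. P ` fano_line c))"
    unfolding two_design_def
  proof (intro conjI ballI impI)
    show "card (range P) = 7" using card_image[OF assms] by simp
    show "card b = 3" "b \<subseteq> range P" if "b \<in> range (\<lambda>c. P ` fano_line c)" for b
      using that card_image[OF inj_on_subset[OF assms subset_UNIV]] card_fano_line by auto
    show "card {b \<in> range (\<lambda>c. P ` fano_line c). x \<in> b \<and> y \<in> b} = 1"
      if "x \<in> range P" "y \<in> range P" "x \<noteq> y" for x y
      using that lines_through by (auto simp: is_singleton_altdef)
  qed simp
  moreover have "inj (\<lambda>c. P ` fano_line c)"
    using inj_fano_line assms by (auto simp: inj_def inj_image_eq_iff)
  ultimately show ?thesis by (simp add: colored_fano_plane_def fano_plane_def)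
qed

definition difference_reps ::
    "('a, 'm) monoid_scheme \<Rightarrow> (7 \<Rightarrow> 'a) set \<Rightarrow> 7 \<Rightarrow> 'a \<Rightarrow> ((7 \<Rightarrow> 'a) \<times> 7 \<times> 7) set" where
  "difference_reps G B c d =
     {(P, i, j). P \<in> B \<and> i \<in> fano_line c \<and> j \<in> fano_line c \<and> P i = d \<otimes>\<^bsub>G\<^esub> P j}"

definition fano_difference_family :: "('a, 'm) monoid_scheme \<Rightarrow> (7 \<Rightarrow> 'a) set \<Rightarrow> bool" where
  "fano_difference_family G B \<longleftrightarrow>
     (\<forall>P\<in>B. inj P \<and> range P \<subseteq> carrier G) \<and>
     (\<forall>c. \<forall>d\<in>carrier G - {\<one>\<^bsub>G\<^esub>}. is_singleton (difference_reps G B c d))"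

lemma fano_difference_familyD:
  assumes "fano_difference_family G B"
  shows "P \<in> B \<Longrightarrow> inj P" "P \<in> B \<Longrightarrow> P i \<in> carrier G"
    and "d \<in> carrier G \<Longrightarrow> d \<noteq> \<one>\<^bsub>G\<^esub> \<Longrightarrow> is_singleton (difference_reps G B c d)"
  using assms by (auto simp: fano_difference_family_def)

lemma is_singleton_image: "is_singleton A \<Longrightarrow> is_singleton (f ` A)"
  by (auto elim!: is_singletonE)

context comm_group
begin

definition translates :: "(7 \<Rightarrow> 'a) set \<Rightarrow> 'a colored_plane set" where
  "translates B = {fano_plane (\<lambda>i. g \<otimes> P i) | g P. g \<in> carrier G \<and> P \<in> B}"

lemma planes_through_pair:
  assumes B: "\<And>P i. P \<in> B \<Longrightarrow> P i \<in> carrier G" and x: "x \<in> carrier G" and y: "y \<in> carrier G"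
  shows "{A \<in> translates B. x \<in> cline A c \<and> y \<in> cline A c}
    = (\<lambda>(P, i, j). fano_plane (\<lambda>k. y \<otimes> inv P j \<otimes> P k)) ` difference_reps G B c (x \<otimes> inv y)"
    (is "?planes = ?plane ` ?reps")
proof (intro equalityI subsetI)
  fix A assume "A \<in> ?planes"
  then obtain g P i j where A: "A = fano_plane (\<lambda>k. g \<otimes> P k)" and g: "g \<in> carrier G" and P: "P \<in> B"
    and ij: "i \<in> fano_line c" "j \<in> fano_line c" and xy: "x = g \<otimes> P i" "y = g \<otimes> P j"
    by (auto simp: translates_def fano_plane_def)
  have "x \<otimes> inv y \<in> carrier G" "x = x \<otimes> inv y \<otimes> y" using x y by (simp_all add: m_assoc)
  then have "g \<otimes> P i = g \<otimes> (x \<otimes> inv y \<otimes> P j)" using xy g B[OF P] by (metis m_lcomm)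
  then have "P i = x \<otimes> inv y \<otimes> P j" using x y g B[OF P] by simp
  moreover have "g = y \<otimes> inv P j" using g B[OF P] by (simp add: xy m_assoc)
  ultimately have "(P, i, j) \<in> ?reps" "A = ?plane (P, i, j)"
    using A P ij by (simp_all add: difference_reps_def)
  then show "A \<in> ?plane ` ?reps" by blast
next
  fix A assume "A \<in> ?plane ` ?reps"
  then obtain P i j where A: "A = fano_plane (\<lambda>k. y \<otimes> inv P j \<otimes> P k)" and P: "P \<in> B"
    and ij: "i \<in> fano_line c" "j \<in> fano_line c" "P i = x \<otimes> inv y \<otimes> P j"
    by (auto simp: difference_reps_def)
  have y_eq: "y = y \<otimes> inv P j \<otimes> P j" using y B[OF P] by (simp add: m_assoc)
  have "y \<otimes> inv P j \<otimes> P i = x \<otimes> inv y \<otimes> (y \<otimes> inv P j \<otimes> P j)"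
    unfolding ij(3) using x y B[OF P] by (intro m_lcomm) simp_all
  also have "\<dots> = x" unfolding y_eq[symmetric] using x y by (simp add: m_assoc)
  finally have "x = y \<otimes> inv P j \<otimes> P i" ..
  with y_eq have "x \<in> cline A c" "y \<in> cline A c"
    unfolding A fano_plane_def using ij(1,2) by auto
  moreover have "A \<in> translates B"
    unfolding A translates_def using P y B by blast
  ultimately show "A \<in> ?planes" by blast
qed

lemma fano_kaleidoscope_translates:
  assumes "finite (carrier G)" and B: "fano_difference_family G B"
  shows "fano_kaleidoscope (order G) (carrier G) (translates B)"
  unfolding fano_kaleidoscope_def
proof (intro conjI ballI allI impI)
  note closed = fano_difference_familyD(2)[OF B]
  fix A assume "A \<in> translates B"
  then obtain g P where A: "A = fano_plane (\<lambda>i. g \<otimes> P i)" and g: "g \<in> carrier G" and P: "P \<in> B"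
    by (auto simp: translates_def)
  have "inj (\<lambda>i. g \<otimes> P i)" using g P closed fano_difference_familyD(1)[OF B P] by (auto simp: inj_def)
  then show "colored_fano_plane A" unfolding A by (rule colored_fano_plane_fano_plane)
  show "points A \<subseteq> carrier G" using A g P closed by (auto simp: fano_plane_def)
next
  note closed = fano_difference_familyD(2)[OF B]
  fix x y c assume "x \<in> carrier G" "y \<in> carrier G" "x \<noteq> y"
  moreover from this have "x \<otimes> inv y \<noteq> \<one>" by (metis inv_closed inv_equality inv_inv)
  ultimately have "is_singleton {A \<in> translates B. x \<in> cline A c \<and> y \<in> cline A c}"
    by (simp add: planes_through_pair closed is_singleton_image fano_difference_familyD(3)[OF B])
  then show "\<exists>!A. A \<in> translates B \<and> x \<in> cline A c \<and> y \<in> cline A c"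
    by (simp add: is_singleton_iff_ex1)
qed (use assms in \<open>simp_all add: order_def\<close>)

abbreviation translation :: "'a \<Rightarrow> 'a \<Rightarrow> 'a" where
  "translation g \<equiv> \<lambda>x\<in>carrier G. g \<otimes> x"

lemma sharply_transitive_translation: "sharply_transitive_action G (carrier G) translation"
  unfolding sharply_transitive_action_def
proof (intro conjI ballI)
  have bij: "translation g \<in> Bij (carrier G)" if "g \<in> carrier G" for g
  proof -
    have "bij_betw (translation g) (carrier G) (carrier G)"
      by (rule bij_betw_byWitness[where f' = "\<lambda>x. inv g \<otimes> x"]) (use that in \<open>auto simp: m_assoc[symmetric]\<close>)
    then show ?thesis by (simp add: Bij_def)
  qed
  show "group_action G (carrier G) translation"
    unfolding group_action_def
    by (rule group_hom.intro[OF is_group group_BijGroup])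
       (auto simp: group_hom_axioms_def hom_def BijGroup_def bij compose_def m_assoc intro!: restrict_ext)
  show "\<exists>!g. g \<in> carrier G \<and> translation g x = y" if "x \<in> carrier G" "y \<in> carrier G" for x y
    by (rule ex1I[of _ "y \<otimes> inv x"]) (use that in \<open>auto simp: m_assoc\<close>)
qed

lemma map_plane_translates:
  assumes B: "\<And>P i. P \<in> B \<Longrightarrow> P i \<in> carrier G" and h: "h \<in> carrier G"
  shows "map_plane (translation h) ` translates B = translates B"
proof -
  have map: "map_plane (translation h) (fano_plane (\<lambda>i. g \<otimes> P i)) = fano_plane (\<lambda>i. (h \<otimes> g) \<otimes> P i)"
    if "g \<in> carrier G" "P \<in> B" for g P
    using that h B by (simp add: map_plane_fano_plane comp_def m_assoc)
  show ?thesis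
  proof (intro equalityI subsetI)
    fix A assume "A \<in> map_plane (translation h) ` translates B"
    then obtain g P where "A = fano_plane (\<lambda>i. (h \<otimes> g) \<otimes> P i)" "g \<in> carrier G" "P \<in> B"
      by (auto simp: translates_def map)
    then show "A \<in> translates B" unfolding translates_def using h by blast
  next
    fix A assume "A \<in> translates B"
    then obtain g P where A: "A = fano_plane (\<lambda>i. g \<otimes> P i)" and g: "g \<in> carrier G" and P: "P \<in> B"
      by (auto simp: translates_def)
    have "A = map_plane (translation h) (fano_plane (\<lambda>i. (inv h \<otimes> g) \<otimes> P i))"
      using A g h P by (simp add: map m_assoc[symmetric])
    moreover have "fano_plane (\<lambda>i. (inv h \<otimes> g) \<otimes> P i) \<in> translates B"
      unfolding translates_def using g h P by blast
    ultimately show "A \<in> map_plane (translation h) ` translates B" by (rule image_eqI)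
  qed
qed

end

theorem fano_difference_family_regular:
  fixes G :: "'a monoid"
  assumes "comm_group G" "finite (carrier G)" and B: "fano_difference_family G B"
  shows "\<exists>F. regular_fano_kaleidoscope (order G) (carrier G) F"
proof -
  interpret comm_group G by fact
  have "\<forall>g\<in>carrier G. map_plane (translation g) ` translates B = translates B"
    using map_plane_translates fano_difference_familyD(2)[OF B] by blast
  then show ?thesis
    unfolding regular_fano_kaleidoscope_def
    using fano_kaleidoscope_translates[OF assms(2) B] sharply_transitive_translation is_group by blast
qed

definition ex_fano_difference_family :: "nat \<Rightarrow> bool" where
  "ex_fano_difference_family v \<longleftrightarrow>
     (\<exists>(G :: nat monoid) B. comm_group G \<and> finite (carrier G) \<and> order G = v \<and> fano_difference_family G B)"

lemma comm_group_iso_nat: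
  fixes G :: "('a, 'm) monoid_scheme" (structure)
  assumes "comm_group G" "finite (carrier G)"
  obtains H :: "nat monoid" and h where "comm_group H" "h \<in> iso G H"
proof -
  interpret comm_group G by fact
  obtain h :: "'a \<Rightarrow> nat" where h: "inj_on h (carrier G)"
    using finite_imp_inj_to_nat_seg[OF assms(2)] by blast
  define k where "k = inv_into (carrier G) h"
  define H :: "nat monoid" where
    "H = \<lparr>carrier = h ` carrier G, monoid.mult = (\<lambda>x y. h (k x \<otimes> k y)), one = h \<one>\<rparr>"
  have k: "k (h x) = x" if "x \<in> carrier G" for x using h that by (simp add: k_def)
  have "comm_group H"
    by (rule comm_groupI) (auto simp: H_def k m_ac, metis inv_closed r_inv)
  moreover have "h \<in> iso G H"
    using h by (auto simp: iso_def hom_def bij_betw_def H_def k)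
  ultimately show thesis by (rule that)
qed

lemma fano_difference_family_iso:
  assumes "group G" "group H" and h: "h \<in> iso G H" and B: "fano_difference_family G B"
  shows "fano_difference_family H ((\<circ>) h ` B)"
proof -
  interpret group_hom G H h
    using assms by (simp add: group_hom_def group_hom_axioms_def iso_def)
  note closed = fano_difference_familyD(2)[OF B]
  have inj: "inj_on h (carrier G)" and image: "h ` carrier G = carrier H"
    using h by (auto simp: iso_def bij_betw_def)
  have reps: "difference_reps H ((\<circ>) h ` B) c (h d) = (\<lambda>(P, i, j). (h \<circ> P, i, j)) ` difference_reps G B c d"
    if "d \<in> carrier G" for c d
  proof -
    have "h (P i) = h d \<otimes>\<^bsub>H\<^esub> h (P j) \<longleftrightarrow> P i = d \<otimes>\<^bsub>G\<^esub> P j" if "P \<in> B" for P i j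
      using inj_on_eq_iff[OF inj, of "P i" "d \<otimes>\<^bsub>G\<^esub> P j"] that closed \<open>d \<in> carrier G\<close> by simp
    then show ?thesis unfolding difference_reps_def by (force simp: image_iff)
  qed
  have "is_singleton (difference_reps H ((\<circ>) h ` B) c e)" if "e \<in> carrier H - {\<one>\<^bsub>H\<^esub>}" for c e
  proof -
    obtain d where d: "e = h d" "d \<in> carrier G" using \<open>e \<in> carrier H - {\<one>\<^bsub>H\<^esub>}\<close> image by blast
    then have "d \<noteq> \<one>\<^bsub>G\<^esub>" using that by auto
    then show ?thesis
      unfolding d(1) reps[OF d(2)] by (intro is_singleton_image fano_difference_familyD(3)[OF B] d(2))
  qed
  moreover have "inj (h \<circ> P)" "range (h \<circ> P) \<subseteq> carrier H" if "P \<in> B" for P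
    using closed that fano_difference_familyD(1)[OF B that] inj by (auto simp: inj_def inj_on_eq_iff)
  ultimately show ?thesis by (auto simp: fano_difference_family_def)
qed

lemma ex_fano_difference_familyI:
  assumes "comm_group G" "finite (carrier G)" "fano_difference_family G B"
  shows "ex_fano_difference_family (order G)"
proof -
  obtain H :: "nat monoid" and h where H: "comm_group H" "h \<in> iso G H"
    using comm_group_iso_nat[OF assms(1,2)] by blast
  have "fano_difference_family H ((\<circ>) h ` B)"
    using assms H by (intro fano_difference_family_iso) (simp_all add: comm_group_def)
  moreover have "order H = order G" "finite (carrier H)"
    using iso_same_card[OF is_isoI[OF H(2)]] iso_finite[OF is_isoI[OF H(2)]] assms(2)
    by (simp_all add: order_def)
  ultimately show ?thesis unfolding ex_fano_difference_family_def using H(1) by blast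
qed

definition spread_points :: "('b, 'm) ring_scheme \<Rightarrow> (7 \<Rightarrow> 'b) \<Rightarrow> (7 \<Rightarrow> 'a) \<Rightarrow> 'b \<Rightarrow> 7 \<Rightarrow> 'a \<times> 'b" where
  "spread_points R \<mu> P h i = (P i, \<mu> i \<otimes>\<^bsub>R\<^esub> h)"

definition fibre_points :: "('a, 'n) monoid_scheme \<Rightarrow> (7 \<Rightarrow> 'b) \<Rightarrow> 7 \<Rightarrow> 'a \<times> 'b" where
  "fibre_points G Q i = (\<one>\<^bsub>G\<^esub>, Q i)"

locale fano_product =
  G: comm_group G + R: ring R
  for G :: "('a, 'n) monoid_scheme" and R :: "('b, 'm) ring_scheme" +
  fixes B :: "(7 \<Rightarrow> 'a) set" and C :: "(7 \<Rightarrow> 'b) set" and \<mu> :: "7 \<Rightarrow> 'b"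
  assumes B: "fano_difference_family G B" and C: "fano_difference_family (add_monoid R) C"
    and multiplier_closed: "\<mu> i \<in> carrier R"
    and multiplier_diff_unit: "i \<noteq> j \<Longrightarrow> \<mu> i \<ominus>\<^bsub>R\<^esub> \<mu> j \<in> Units R"
begin

definition base_planes :: "(7 \<Rightarrow> 'a \<times> 'b) set" where
  "base_planes = {spread_points R \<mu> P h | P h. P \<in> B \<and> h \<in> carrier R} \<union> fibre_points G ` C"

lemma scaled_multiplier_diff_iff:
  assumes "i \<noteq> j" "h \<in> carrier R" "y \<in> carrier R"
  shows "\<mu> i \<otimes>\<^bsub>R\<^esub> h = y \<oplus>\<^bsub>R\<^esub> \<mu> j \<otimes>\<^bsub>R\<^esub> h \<longleftrightarrow> h = inv\<^bsub>R\<^esub> (\<mu> i \<ominus>\<^bsub>R\<^esub> \<mu> j) \<otimes>\<^bsub>R\<^esub> y"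
proof -
  note unit = multiplier_diff_unit[OF assms(1)]
  have "(\<mu> i \<ominus>\<^bsub>R\<^esub> \<mu> j) \<otimes>\<^bsub>R\<^esub> h = \<mu> i \<otimes>\<^bsub>R\<^esub> h \<oplus>\<^bsub>R\<^esub> \<ominus>\<^bsub>R\<^esub> (\<mu> j \<otimes>\<^bsub>R\<^esub> h)"
    using multiplier_closed assms(2) by (simp add: R.minus_eq R.l_distr R.l_minus)
  then have "\<mu> i \<otimes>\<^bsub>R\<^esub> h = y \<oplus>\<^bsub>R\<^esub> \<mu> j \<otimes>\<^bsub>R\<^esub> h \<longleftrightarrow> (\<mu> i \<ominus>\<^bsub>R\<^esub> \<mu> j) \<otimes>\<^bsub>R\<^esub> h = y"
    using R.add.inv_solve_right[of y "\<mu> i \<otimes>\<^bsub>R\<^esub> h" "\<mu> j \<otimes>\<^bsub>R\<^esub> h"] multiplier_closed assms(2,3) by auto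
  also have "\<dots> \<longleftrightarrow> h = inv\<^bsub>R\<^esub> (\<mu> i \<ominus>\<^bsub>R\<^esub> \<mu> j) \<otimes>\<^bsub>R\<^esub> y"
    using unit assms(2,3) by (auto simp: R.m_assoc[symmetric] R.Units_closed)
  finally show ?thesis .
qed

lemma difference_reps_across:
  assumes x: "x \<in> carrier G" "x \<noteq> \<one>\<^bsub>G\<^esub>" and y: "y \<in> carrier R"
  shows "difference_reps (G \<times>\<times> add_monoid R) base_planes c (x, y)
    = (\<lambda>(P, i, j). (spread_points R \<mu> P (inv\<^bsub>R\<^esub> (\<mu> i \<ominus>\<^bsub>R\<^esub> \<mu> j) \<otimes>\<^bsub>R\<^esub> y), i, j)) ` difference_reps G B c x"
    (is "?reps = ?lift ` _")
proof (intro equalityI subsetI)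
  have neq: "i \<noteq> j" if "(P, i, j) \<in> difference_reps G B c x" for P i j
    using that x fano_difference_familyD(2)[OF B] by (auto simp: difference_reps_def)
  fix t assume "t \<in> ?reps"
  then obtain P h i j where t: "t = (spread_points R \<mu> P h, i, j)" and h: "h \<in> carrier R"
    and reps: "(P, i, j) \<in> difference_reps G B c x"
    and eq: "\<mu> i \<otimes>\<^bsub>R\<^esub> h = y \<oplus>\<^bsub>R\<^esub> \<mu> j \<otimes>\<^bsub>R\<^esub> h"
    using x by (auto simp: difference_reps_def base_planes_def spread_points_def fibre_points_def)
  have "t = ?lift (P, i, j)" using t eq scaled_multiplier_diff_iff[OF neq[OF reps] h y] by simp
  then show "t \<in> ?lift ` difference_reps G B c x" using reps by blast
next
  fix t assume "t \<in> ?lift ` difference_reps G B c x"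
  then obtain P i j where t: "t = ?lift (P, i, j)" and reps: "(P, i, j) \<in> difference_reps G B c x"
    by force
  have neq: "i \<noteq> j" using reps x fano_difference_familyD(2)[OF B] by (auto simp: difference_reps_def)
  define h where "h = inv\<^bsub>R\<^esub> (\<mu> i \<ominus>\<^bsub>R\<^esub> \<mu> j) \<otimes>\<^bsub>R\<^esub> y"
  have h: "h \<in> carrier R" using multiplier_diff_unit[OF neq] y by (simp add: h_def)
  then have "\<mu> i \<otimes>\<^bsub>R\<^esub> h = y \<oplus>\<^bsub>R\<^esub> \<mu> j \<otimes>\<^bsub>R\<^esub> h"
    using scaled_multiplier_diff_iff[OF neq h y] by (simp add: h_def)
  then show "t \<in> ?reps"
    using t reps h by (auto simp: h_def[symmetric] difference_reps_def base_planes_def spread_points_def)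
qed

lemma difference_reps_fibre:
  assumes y: "y \<in> carrier R" "y \<noteq> \<zero>\<^bsub>R\<^esub>"
  shows "difference_reps (G \<times>\<times> add_monoid R) base_planes c (\<one>\<^bsub>G\<^esub>, y)
    = (\<lambda>(Q, i, j). (fibre_points G Q, i, j)) ` difference_reps (add_monoid R) C c y"
proof -
  have "spread_points R \<mu> P h i \<noteq> (\<one>\<^bsub>G\<^esub>, y) \<otimes>\<^bsub>G \<times>\<times> add_monoid R\<^esub> spread_points R \<mu> P h j"
    if "P \<in> B" "h \<in> carrier R" for P h i j
  proof
    assume eq: "spread_points R \<mu> P h i = (\<one>\<^bsub>G\<^esub>, y) \<otimes>\<^bsub>G \<times>\<times> add_monoid R\<^esub> spread_points R \<mu> P h j"
    then have "P i = P j" using that fano_difference_familyD(2)[OF B] by (simp add: spread_points_def)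
    then have "i = j" using that fano_difference_familyD(1)[OF B] by (simp add: inj_eq)
    then have "\<mu> j \<otimes>\<^bsub>R\<^esub> h = y \<oplus>\<^bsub>R\<^esub> \<mu> j \<otimes>\<^bsub>R\<^esub> h" using eq by (simp add: spread_points_def)
    then show False using that y multiplier_closed by (metis R.add.r_cancel_one' R.m_closed)
  qed
  moreover have "fibre_points G Q i = (\<one>\<^bsub>G\<^esub>, y) \<otimes>\<^bsub>G \<times>\<times> add_monoid R\<^esub> fibre_points G Q j \<longleftrightarrow> Q i = y \<oplus>\<^bsub>R\<^esub> Q j"
    for Q i j by (simp add: fibre_points_def)
  ultimately show ?thesis
    unfolding difference_reps_def base_planes_def by (force simp: image_iff)
qed

theorem fano_difference_family_base_planes:
  "fano_difference_family (G \<times>\<times> add_monoid R) base_planes"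
  unfolding fano_difference_family_def
proof (intro conjI ballI allI)
  fix P assume "P \<in> base_planes"
  then show "inj P" "range P \<subseteq> carrier (G \<times>\<times> add_monoid R)"
    using fano_difference_familyD(1,2)[OF B] fano_difference_familyD(1,2)[OF C] multiplier_closed
    by (auto simp: base_planes_def spread_points_def fibre_points_def inj_def)
next
  fix c d assume d: "d \<in> carrier (G \<times>\<times> add_monoid R) - {\<one>\<^bsub>G \<times>\<times> add_monoid R\<^esub>}"
  obtain x y where xy: "d = (x, y)" "x \<in> carrier G" "y \<in> carrier R" using d by auto
  show "is_singleton (difference_reps (G \<times>\<times> add_monoid R) base_planes c d)"
  proof (cases "x = \<one>\<^bsub>G\<^esub>")
    case True
    then have "y \<noteq> \<zero>\<^bsub>R\<^esub>" using d xy by simp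
    then show ?thesis
      using True xy fano_difference_familyD(3)[OF C] by (simp add: difference_reps_fibre is_singleton_image)
  next
    case False
    then show ?thesis
      using xy fano_difference_familyD(3)[OF B] by (simp add: difference_reps_across is_singleton_image)
  qed
qed

end

lemma ex_fano_difference_family_mult:
  fixes R :: "('b, 'm) ring_scheme"
  assumes "ex_fano_difference_family v" and R: "field R" "finite (carrier R)" "7 \<le> order R"
    and C: "fano_difference_family (add_monoid R) C"
  shows "ex_fano_difference_family (v * order R)"
proof -
  obtain G :: "nat monoid" and B where "comm_group G" and G: "finite (carrier G)" "order G = v"
    and B: "fano_difference_family G B"
    using assms(1) unfolding ex_fano_difference_family_def by blast
  interpret G: comm_group G by fact
  interpret R: field R by fact
  obtain \<mu> :: "7 \<Rightarrow> 'b" where \<mu>: "inj \<mu>" "range \<mu> \<subseteq> carrier R"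
    using card_le_inj[of "UNIV :: 7 set" "carrier R"] R by (auto simp: order_def)
  then have "\<mu> i \<in> carrier R" for i by blast
  moreover have "\<mu> i \<ominus>\<^bsub>R\<^esub> \<mu> j \<in> Units R" if "i \<noteq> j" for i j
    using that \<mu> calculation by (simp add: R.field_Units inj_eq)
  ultimately interpret fano_product G R B C \<mu>
    by unfold_locales (use B C in auto)
  interpret GR: group "G \<times>\<times> add_monoid R"
    by (intro DirProd_group G.is_group) (rule abelian_group.a_group, unfold_locales)
  have "comm_group (G \<times>\<times> add_monoid R)"
    by (rule GR.group_comm_groupI) (auto simp: G.m_comm R.a_comm)
  then have "ex_fano_difference_family (order (G \<times>\<times> add_monoid R))"
    using G R(2) fano_difference_family_base_planes by (intro ex_fano_difference_familyI) auto
  then show ?thesis using G by (simp add: order_def card_cartesian_product)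
qed

section \<open>Finite fields with cubic residue symbol\<close>

definition cubic_symbol :: "('a, 'm) ring_scheme \<Rightarrow> 'a \<Rightarrow> 'a" where
  "cubic_symbol R x = x [^]\<^bsub>R\<^esub> ((order R - 1) div 3)"

definition difference_symbol :: "('a, 'm) ring_scheme \<Rightarrow> 'a \<Rightarrow> 'a \<Rightarrow> 'a" where
  "difference_symbol R x y = cubic_symbol R (x \<ominus>\<^bsub>R\<^esub> y)"

locale cubic_residue_field = field R for R :: "('a, 'm) ring_scheme" (structure) +
  assumes finite_carrier: "finite (carrier R)"
    and order_mod_6: "order R mod 6 = 1"
begin

abbreviation \<tau> :: "'a \<Rightarrow> 'a" where "\<tau> \<equiv> cubic_symbol R"

abbreviation \<delta> :: "'a \<Rightarrow> 'a \<Rightarrow> 'a" where "\<delta> \<equiv> difference_symbol R"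

lemma order_ge_7: "order R \<ge> 7"
proof -
  have "card {\<zero>, \<one>} \<le> order R" unfolding order_def by (rule card_mono[OF finite_carrier]) simp
  then show ?thesis using order_mod_6 by simp presburger
qed

lemma cubic_symbol_closed [simp]: "x \<in> carrier R \<Longrightarrow> \<tau> x \<in> carrier R"
  by (simp add: cubic_symbol_def)

lemma cubic_symbol_one [simp]: "\<tau> \<one> = \<one>"
  by (simp add: cubic_symbol_def)

lemma cubic_symbol_zero [simp]: "\<tau> \<zero> = \<zero>"
proof -
  have "(order R - 1) div 3 \<noteq> 0" using order_ge_7 by simp
  then show ?thesis by (simp add: cubic_symbol_def nat_pow_zero)
qed

lemma cubic_symbol_mult: "x \<in> carrier R \<Longrightarrow> y \<in> carrier R \<Longrightarrow> \<tau> (x \<otimes> y) = \<tau> x \<otimes> \<tau> y"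
  by (simp add: cubic_symbol_def nat_pow_distrib)

lemma cubic_symbol_minus:
  assumes "x \<in> carrier R"
  shows "\<tau> (\<ominus> x) = \<tau> x"
proof -
  have "even ((order R - 1) div 3)" using order_mod_6 by presburger
  then obtain k where k: "(order R - 1) div 3 = 2 * k" by blast
  have "(\<ominus> x) [^] (2::nat) = x [^] (2::nat)"
    using assms by (simp add: numeral_2_eq_2 l_minus r_minus)
  then show ?thesis using assms unfolding cubic_symbol_def k by (metis nat_pow_pow a_inv_closed)
qed

lemma difference_symbol_commute:
  "x \<in> carrier R \<Longrightarrow> y \<in> carrier R \<Longrightarrow> \<delta> x y = \<delta> y x"
  using cubic_symbol_minus[of "y \<ominus> x"] by (simp add: difference_symbol_def minus_eq minus_add a_comm)

lemma cubic_symbol_cubed: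
  assumes "x \<in> carrier R" "x \<noteq> \<zero>"
  shows "\<tau> x [^] (3::nat) = \<one>"
proof -
  interpret M: group "mult_of R" by (rule field_mult_group)
  have "x [^]\<^bsub>mult_of R\<^esub> order (mult_of R) = \<one>\<^bsub>mult_of R\<^esub>"
    using assms by (intro M.pow_order_eq_1) simp
  then have "x [^] (order R - 1) = \<one>"
    by (simp add: nat_pow_mult_of order_mult_of[OF finite_carrier])
  moreover have "(order R - 1) div 3 * 3 = order R - 1" using order_mod_6 by presburger
  ultimately show ?thesis using assms by (simp add: cubic_symbol_def nat_pow_pow)
qed

lemma cubic_symbol_eq_zero_iff: "x \<in> carrier R \<Longrightarrow> \<tau> x = \<zero> \<longleftrightarrow> x = \<zero>"
  using cubic_symbol_cubed[of x] by (cases "x = \<zero>") (auto simp: nat_pow_zero)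

lemma card_cubic_symbols_le: "card (\<tau> ` (carrier R - {\<zero>})) \<le> 3"
proof -
  have "card (\<tau> ` (carrier R - {\<zero>})) \<le> card {x \<in> carrier R. x [^] (3::nat) = \<one>}"
    using finite_carrier by (intro card_mono) (auto simp: cubic_symbol_cubed)
  also have "\<dots> \<le> 3" by (rule num_roots_le_deg[OF finite_carrier]) simp
  finally show ?thesis .
qed

lemma minus_neq_self:
  assumes "x \<in> carrier R" "x \<noteq> \<zero>"
  shows "\<ominus> x \<noteq> x"
proof
  assume "\<ominus> x = x"
  have "x \<oplus> x = \<zero>" using assms \<open>\<ominus> x = x\<close> r_neg[of x] by simp
  then have "add.ord x dvd 2" using add.pow_eq_id[OF assms(1), of 2] assms by (simp add: numeral_2_eq_2)
  moreover have "add.ord x dvd order R" using add.ord_dvd_group_order[OF assms(1)] by (simp add: order_def)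
  moreover have "coprime 2 (order R)" using order_mod_6 by (simp, presburger)
  ultimately have "add.ord x = 1" using coprime_common_divisor_nat by blast
  then show False using add.ord_eq_1[OF assms(1)] assms by simp
qed

definition cubes :: "'a set" where
  "cubes = {h \<in> carrier R. h \<noteq> \<zero> \<and> \<tau> h = \<one>}"

definition half_system :: "'a set \<Rightarrow> bool" where
  "half_system S \<longleftrightarrow> S \<subseteq> cubes \<and> (\<forall>h\<in>cubes. h \<in> S \<longleftrightarrow> \<ominus> h \<notin> S)"

lemma half_systemD:
  assumes "half_system S" "s \<in> S"
  shows "s \<in> carrier R" "s \<noteq> \<zero>" "\<tau> s = \<one>" "\<ominus> s \<notin> S"
  using assms by (auto simp: half_system_def cubes_def)

lemma half_system_exists: "\<exists>S. half_system S"
proof -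
  obtain f :: "'a \<Rightarrow> nat" where f: "inj_on f (carrier R)"
    using finite_imp_inj_to_nat_seg[OF finite_carrier] by blast
  have "f h < f (\<ominus> h) \<longleftrightarrow> \<not> f (\<ominus> h) < f h" if "h \<in> cubes" for h
    using that minus_neq_self[of h] inj_on_eq_iff[OF f, of h "\<ominus> h"] by (auto simp: cubes_def)
  then have "half_system {h \<in> cubes. f h < f (\<ominus> h)}"
    by (auto simp: half_system_def cubes_def cubic_symbol_minus)
  then show ?thesis by blast
qed

definition scaled_planes :: "'a set \<Rightarrow> (7 \<Rightarrow> 'a) \<Rightarrow> (7 \<Rightarrow> 'a) set" where
  "scaled_planes S P = (\<lambda>s i. s \<otimes> P i) ` S"

context
  fixes P :: "7 \<Rightarrow> 'a" and S :: "'a set"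
  assumes P_closed: "range P \<subseteq> carrier R" and rainbow_P: "rainbow_fano \<delta> P" and S: "half_system S"
begin

lemma point_closed: "P i \<in> carrier R"
  using P_closed by blast

lemma difference_closed: "P i \<ominus> P j \<in> carrier R"
  by (intro minus_closed point_closed)

lemma rainbow_fano_covers:
  assumes "d \<in> carrier R" "d \<noteq> \<zero>"
  obtains i j where "i \<in> fano_line c" "j \<in> fano_line c" "P i \<noteq> P j" "\<tau> (P i \<ominus> P j) = \<tau> d"
proof -
  define D where "D = {\<delta> (P c) (P (c + 1)), \<delta> (P (c + 1)) (P (c + 3)), \<delta> (P c) (P (c + 3))}"
  have rainbow: "rainbow \<delta> (P c) (P (c + 1)) (P (c + 3))"
    using rainbow_P by (simp add: rainbow_fano_def)
  have "D = \<tau> ` (carrier R - {\<zero>})"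
  proof (rule card_seteq)
    show "D \<subseteq> \<tau> ` (carrier R - {\<zero>})"
      using rainbow difference_closed by (auto simp: D_def rainbow_def difference_symbol_def point_closed)
    have "card D = 3" using rainbow by (simp add: D_def rainbow_def)
    then show "card (\<tau> ` (carrier R - {\<zero>})) \<le> card D" using card_cubic_symbols_le by simp
  qed (use finite_carrier in simp)
  then have "\<tau> d \<in> D" using assms by blast
  then consider "\<tau> (P c \<ominus> P (c + 1)) = \<tau> d" | "\<tau> (P (c + 1) \<ominus> P (c + 3)) = \<tau> d" | "\<tau> (P c \<ominus> P (c + 3)) = \<tau> d"
    by (auto simp: D_def difference_symbol_def)
  then show thesis
    using rainbow that unfolding rainbow_def fano_line_def by cases auto
qed

lemma scaled_difference_exists:
  assumes d: "d \<in> carrier R" "d \<noteq> \<zero>"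
  obtains s i j where "s \<in> S" "i \<in> fano_line c" "j \<in> fano_line c" "s \<otimes> (P i \<ominus> P j) = d"
proof -
  obtain i j where ij: "i \<in> fano_line c" "j \<in> fano_line c" and neq: "P i \<noteq> P j"
    and symbol: "\<tau> (P i \<ominus> P j) = \<tau> d"
    using rainbow_fano_covers[OF d] by blast
  define e where "e = P i \<ominus> P j"
  have e: "e \<in> Units R" using neq point_closed by (simp add: e_def field_Units)
  define h where "h = d \<otimes> inv e"
  have h: "h \<in> carrier R" "h \<otimes> e = d" using d e by (simp_all add: h_def m_assoc Units_closed)
  then have "h \<noteq> \<zero>" using d e by (auto simp: Units_closed)
  have "\<tau> h \<otimes> \<tau> e = \<one> \<otimes> \<tau> e"
    using cubic_symbol_mult[of h e] h e d symbol by (simp add: e_def Units_closed)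
  then have "\<tau> h = \<one>"
    using e h cubic_symbol_eq_zero_iff[of e] m_rcancel[of "\<tau> e" "\<tau> h" \<one>] by (simp add: field_Units)
  then have "h \<in> S \<or> \<ominus> h \<in> S" using h \<open>h \<noteq> \<zero>\<close> S by (auto simp: half_system_def cubes_def)
  then show thesis
  proof
    assume "h \<in> S"
    then show thesis using that ij h by (simp add: e_def)
  next
    assume "\<ominus> h \<in> S"
    moreover have "\<ominus> h \<otimes> (P j \<ominus> P i) = h \<otimes> e"
      unfolding e_def using h(1) point_closed[of i] point_closed[of j] by algebra
    ultimately show thesis using that ij h by metis
  qed
qed

lemma scaled_difference_unique:
  assumes s: "s \<in> S" "s' \<in> S" and ij: "i \<in> fano_line c" "j \<in> fano_line c" "i' \<in> fano_line c" "j' \<in> fano_line c"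
    and eq: "s \<otimes> (P i \<ominus> P j) = s' \<otimes> (P i' \<ominus> P j')" and nonzero: "s \<otimes> (P i \<ominus> P j) \<noteq> \<zero>"
  shows "s = s' \<and> i = i' \<and> j = j'"
proof -
  note sc = half_systemD[OF S s(1)] and sc' = half_systemD[OF S s(2)]
  have "P i \<noteq> P j" using nonzero sc point_closed[of j] by (auto simp: minus_eq r_neg)
  moreover have "P i' \<noteq> P j'" using nonzero eq sc' point_closed[of j'] by (auto simp: minus_eq r_neg)
  ultimately have "i \<noteq> j" "i' \<noteq> j'" by auto
  have "\<tau> (P i \<ominus> P j) = \<tau> (P i' \<ominus> P j')"
    using arg_cong[OF eq, of \<tau>] sc sc' difference_closed by (simp add: cubic_symbol_mult)
  then have "i' = i \<and> j' = j \<or> i' = j \<and> j' = i"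
    using ij \<open>i \<noteq> j\<close> \<open>i' \<noteq> j'\<close> difference_symbol_commute[OF point_closed point_closed]
    by (intro rainbow_fano_pair_unique[OF rainbow_P]) (auto simp: difference_symbol_def)
  then show ?thesis
  proof
    assume swap: "i' = j \<and> j' = i"
    have "s' \<otimes> (P j \<ominus> P i) = \<ominus> s' \<otimes> (P i \<ominus> P j)"
      using sc'(1) point_closed[of i] point_closed[of j] by algebra
    then have "s = \<ominus> s'"
      using eq swap m_rcancel[OF _ difference_closed sc(1), of i j "\<ominus> s'"] sc' \<open>P i \<noteq> P j\<close> point_closed by simp
    then show ?thesis using sc'(4) s(1) by simp
  next
    assume "i' = i \<and> j' = j"
    then show ?thesis
      using eq m_rcancel[OF _ difference_closed sc(1) sc'(1), of i j] \<open>P i \<noteq> P j\<close> point_closed by simp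
  qed
qed

lemma scaled_point_eq_iff:
  assumes "s \<in> S" "d \<in> carrier R"
  shows "s \<otimes> P i = d \<oplus> s \<otimes> P j \<longleftrightarrow> s \<otimes> (P i \<ominus> P j) = d"
proof -
  note s = half_systemD(1)[OF S assms(1)]
  have "s \<otimes> (P i \<ominus> P j) = s \<otimes> P i \<oplus> \<ominus> (s \<otimes> P j)"
    using s point_closed by (simp add: minus_eq r_distr r_minus)
  then show ?thesis
    using add.inv_solve_right[of d "s \<otimes> P i" "s \<otimes> P j"] s assms(2) point_closed by auto
qed

theorem fano_difference_family_scaled_planes:
  "fano_difference_family (add_monoid R) (scaled_planes S P)"
  unfolding fano_difference_family_def
proof (intro conjI ballI allI)
  fix T assume "T \<in> scaled_planes S P"
  then obtain s where s: "s \<in> S" "T = (\<lambda>i. s \<otimes> P i)" by (auto simp: scaled_planes_def)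
  then show "inj T"
    using half_systemD[OF S s(1)] rainbow_fano_inj[OF rainbow_P] point_closed
    by (auto simp: inj_def m_lcancel)
  show "range T \<subseteq> carrier (add_monoid R)" using s half_systemD[OF S s(1)] point_closed by auto
next
  fix c d assume "d \<in> carrier (add_monoid R) - {\<one>\<^bsub>add_monoid R\<^esub>}"
  then have d: "d \<in> carrier R" "d \<noteq> \<zero>" by auto
  show "is_singleton (difference_reps (add_monoid R) (scaled_planes S P) c d)"
  proof (rule is_singletonI')
    obtain s i j where "s \<in> S" "i \<in> fano_line c" "j \<in> fano_line c" "s \<otimes> (P i \<ominus> P j) = d"
      using scaled_difference_exists[OF d] by blast
    then have "(\<lambda>i. s \<otimes> P i, i, j) \<in> difference_reps (add_monoid R) (scaled_planes S P) c d"
      using scaled_point_eq_iff[of s d i j] d(1) by (simp add: difference_reps_def scaled_planes_def)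
    then show "difference_reps (add_monoid R) (scaled_planes S P) c d \<noteq> {}" by blast
  next
    fix t t' assume t: "t \<in> difference_reps (add_monoid R) (scaled_planes S P) c d"
      "t' \<in> difference_reps (add_monoid R) (scaled_planes S P) c d"
    have "\<exists>s i j. t = (\<lambda>i. s \<otimes> P i, i, j) \<and> s \<in> S \<and> i \<in> fano_line c \<and> j \<in> fano_line c \<and>
        s \<otimes> (P i \<ominus> P j) = d"
      if "t \<in> difference_reps (add_monoid R) (scaled_planes S P) c d" for t
      using that d(1) by (auto simp: difference_reps_def scaled_planes_def scaled_point_eq_iff)
    from this[OF t(1)] this[OF t(2)] show "t = t'"
      using scaled_difference_unique d(2) by (elim exE conjE) (metis (no_types, lifting))
  qed
qed

end

lemma has_rainbow_fano_difference_family: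
  assumes "has_rainbow_fano (carrier R) \<delta>"
  shows "\<exists>B. fano_difference_family (add_monoid R) B"
  using assms half_system_exists fano_difference_family_scaled_planes
  unfolding has_rainbow_fano_def by blast

end

section \<open>Rainbow Fano planes in quasirandom colourings\<close>

lemma norm_sum_mult_le:
  fixes f g :: "'a \<Rightarrow> complex"
  shows "(cmod (\<Sum>x\<in>A. f x * g x))\<^sup>2 \<le> (\<Sum>x\<in>A. (cmod (f x))\<^sup>2) * (\<Sum>x\<in>A. (cmod (g x))\<^sup>2)"
proof -
  have "cmod (\<Sum>x\<in>A. f x * g x) \<le> (\<Sum>x\<in>A. cmod (f x) * cmod (g x))"
    by (rule order_trans[OF norm_sum]) (simp add: norm_mult)
  then have "(cmod (\<Sum>x\<in>A. f x * g x))\<^sup>2 \<le> (\<Sum>x\<in>A. cmod (f x) * cmod (g x))\<^sup>2"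
    by (rule power_mono) simp
  also have "\<dots> \<le> (\<Sum>x\<in>A. (cmod (f x))\<^sup>2) * (\<Sum>x\<in>A. (cmod (g x))\<^sup>2)"
    by (rule Cauchy_Schwarz_ineq_sum)
  finally show ?thesis .
qed

lemma sum_off_diagonal:
  fixes f :: "'a \<Rightarrow> 'a \<Rightarrow> real" and a b :: real
  assumes "finite K" and diag: "\<And>x. x \<in> K \<Longrightarrow> f x x = a"
    and off: "\<And>x y. x \<in> K \<Longrightarrow> y \<in> K \<Longrightarrow> x \<noteq> y \<Longrightarrow> f x y = b"
  shows "(\<Sum>x\<in>K. \<Sum>y\<in>K. f x y) = card K * a + card K * (real (card K) - 1) * b"
proof -
  have "(\<Sum>x\<in>K. \<Sum>y\<in>K. f x y) = (\<Sum>x\<in>K. \<Sum>y\<in>K. b + (if y = x then a - b else 0))"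
    using diag off by (intro sum.cong) auto
  also have "\<dots> = card K * (card K * b + (a - b))"
    using assms(1) by (simp add: sum.distrib)
  finally show ?thesis by (simp add: algebra_simps)
qed

lemma sum_Gram:
  fixes g :: "'a \<Rightarrow> 'e \<Rightarrow> real"
  shows "(\<Sum>e\<in>E. \<Sum>e'\<in>E. \<Sum>u\<in>K. g u e * g u e') = (\<Sum>u\<in>K. (\<Sum>e\<in>E. g u e)\<^sup>2)"
proof -
  have "(\<Sum>e\<in>E. \<Sum>e'\<in>E. \<Sum>u\<in>K. g u e * g u e') = (\<Sum>u\<in>K. \<Sum>e\<in>E. \<Sum>e'\<in>E. g u e * g u e')"
    by (subst (2) sum.swap) (subst sum.swap, rule refl)
  then show ?thesis by (simp add: power2_eq_square sum_product)
qed

lemma sum_Gram_square: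
  fixes g :: "'a \<Rightarrow> 'e \<Rightarrow> real"
  shows "(\<Sum>e\<in>E. \<Sum>e'\<in>E. (\<Sum>u\<in>K. g u e * g u e')\<^sup>2) = (\<Sum>u\<in>K. \<Sum>v\<in>K. (\<Sum>e\<in>E. g u e * g v e)\<^sup>2)"
proof -
  have "(\<Sum>e\<in>E. \<Sum>e'\<in>E. (\<Sum>u\<in>K. g u e * g u e')\<^sup>2)
      = (\<Sum>e\<in>E. \<Sum>e'\<in>E. \<Sum>u\<in>K. \<Sum>v\<in>K. (g u e * g v e) * (g u e' * g v e'))"
    by (simp add: power2_eq_square sum_product mult_ac)
  also have "\<dots> = (\<Sum>e\<in>E. \<Sum>u\<in>K. \<Sum>v\<in>K. \<Sum>e'\<in>E. (g u e * g v e) * (g u e' * g v e'))"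
    by (intro sum.cong refl) (subst sum.swap, intro sum.cong refl sum.swap)
  also have "\<dots> = (\<Sum>u\<in>K. \<Sum>v\<in>K. \<Sum>e\<in>E. \<Sum>e'\<in>E. (g u e * g v e) * (g u e' * g v e'))"
    by (subst sum.swap, intro sum.cong refl sum.swap)
  finally show ?thesis by (simp add: power2_eq_square sum_product)
qed

lemma Chebyshev_permuted:
  fixes g :: "'a \<Rightarrow> real" and \<mu> \<epsilon> :: real
  assumes "finite \<Omega>" "finite S" "0 \<le> \<epsilon>" and perm: "\<And>\<pi>. \<pi> \<in> S \<Longrightarrow> bij_betw \<pi> \<Omega> \<Omega>"
    and small: "card S * (\<Sum>\<omega>\<in>\<Omega>. (g \<omega> - \<mu>)\<^sup>2) < card \<Omega> * \<epsilon>\<^sup>2"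
  shows "\<exists>\<omega>\<in>\<Omega>. \<forall>\<pi>\<in>S. \<bar>g (\<pi> \<omega>) - \<mu>\<bar> < \<epsilon>"
proof (rule ccontr)
  assume "\<not> ?thesis"
  then have far: "\<exists>\<pi>\<in>S. \<epsilon> \<le> \<bar>g (\<pi> \<omega>) - \<mu>\<bar>" if "\<omega> \<in> \<Omega>" for \<omega>
    using that by (auto simp: not_less)
  have "\<epsilon>\<^sup>2 \<le> (\<Sum>\<pi>\<in>S. (g (\<pi> \<omega>) - \<mu>)\<^sup>2)" if "\<omega> \<in> \<Omega>" for \<omega>
  proof -
    obtain \<pi> where \<pi>: "\<pi> \<in> S" "\<epsilon> \<le> \<bar>g (\<pi> \<omega>) - \<mu>\<bar>" using far \<open>\<omega> \<in> \<Omega>\<close> by blast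
    have "\<epsilon>\<^sup>2 \<le> (g (\<pi> \<omega>) - \<mu>)\<^sup>2" using power_mono[OF \<pi>(2) \<open>0 \<le> \<epsilon>\<close>, of 2] by simp
    also have "\<dots> \<le> (\<Sum>\<pi>\<in>S. (g (\<pi> \<omega>) - \<mu>)\<^sup>2)"
      using \<pi>(1) \<open>finite S\<close> by (intro member_le_sum) auto
    finally show ?thesis .
  qed
  then have "card \<Omega> * \<epsilon>\<^sup>2 \<le> (\<Sum>\<omega>\<in>\<Omega>. \<Sum>\<pi>\<in>S. (g (\<pi> \<omega>) - \<mu>)\<^sup>2)"
    using sum_mono[of \<Omega> "\<lambda>_. \<epsilon>\<^sup>2"] by simp
  also have "\<dots> = (\<Sum>\<pi>\<in>S. \<Sum>\<omega>\<in>\<Omega>. (g (\<pi> \<omega>) - \<mu>)\<^sup>2)" by (rule sum.swap)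
  also have "\<dots> = (\<Sum>\<pi>\<in>S. \<Sum>\<omega>\<in>\<Omega>. (g \<omega> - \<mu>)\<^sup>2)"
    using perm by (intro sum.cong refl sum.reindex_bij_betw)
  finally show False using small by simp
qed

lemma sum_triple_diagonal_le:
  assumes "finite V" "finite W"
  shows "(\<Sum>u\<in>U. \<Sum>v\<in>V. \<Sum>w\<in>W. of_bool (u = v \<and> v = w)) \<le> real (card U)"
proof -
  have "(\<Sum>v\<in>V. \<Sum>w\<in>W. of_bool (u = v \<and> v = w)) \<le> (1::real)" for u
  proof -
    have "(\<Sum>v\<in>V. \<Sum>w\<in>W. of_bool (u = v \<and> v = w)) = (\<Sum>v\<in>V. if v = u then of_bool (v \<in> W) else (0::real))"
      using assms(2) by (intro sum.cong) (auto simp: of_bool_def)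
    also have "\<dots> \<le> 1" using assms(1) by simp
    finally show ?thesis .
  qed
  then show ?thesis using sum_mono[of U _ "\<lambda>_. 1::real"] by simp
qed

definition omega :: complex where
  "omega = Complex (-1/2) (sqrt 3 / 2)"

lemma cube_roots_of_unity:
  fixes z :: complex
  shows "z ^ 3 = 1 \<longleftrightarrow> z \<in> {1, omega, cnj omega}"
proof -
  have "(z - 1) * ((z - omega) * (z - cnj omega)) = z ^ 3 - 1"
    by (simp add: omega_def complex_eq_iff power3_eq_cube algebra_simps)
  then show ?thesis by (metis insertCI insertE right_minus_eq mult_eq_0_iff singletonD)
qed

lemma omega_neq: "omega \<noteq> 1" "cnj omega \<noteq> 1" "omega \<noteq> cnj omega" "omega \<noteq> 0"
  by (simp_all add: omega_def complex_eq_iff)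

lemma omega_mult: "omega * omega = cnj omega" "cnj omega * cnj omega = omega"
    "omega * cnj omega = 1" "cnj omega * omega = 1"
  by (simp_all add: omega_def complex_eq_iff)

lemma distinct_cube_roots_expansion:
  fixes \<alpha> \<beta> \<gamma> :: complex
  assumes "\<alpha> ^ 3 = 1" "\<beta> ^ 3 = 1" "\<gamma> ^ 3 = 1"
  shows "of_bool (distinct [\<alpha>, \<beta>, \<gamma>]) = 2 / 9 * (1 + 2 * Re (\<alpha> * \<beta> * \<gamma>)
     - Re (\<alpha> * cnj \<beta>) - Re (\<beta> * cnj \<gamma>) - Re (\<gamma> * cnj \<alpha>))"
  using assms unfolding cube_roots_of_unity
  by (elim insertE emptyE; hypsubst) (simp_all add: omega_def complex_eq_iff)

text \<open>
  Modelled on \<open>\<chi> x y = \<psi> (x - y)\<close> for a cubic character \<open>\<psi>\<close> of a finite field; the maps in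
  \<open>two_transitive\<close> are the affine ones.
\<close>

locale cubic_colouring =
  fixes K :: "'a set" and \<chi> :: "'a \<Rightarrow> 'a \<Rightarrow> complex"
  assumes finite_K: "finite K"
    and chi_refl: "x \<in> K \<Longrightarrow> \<chi> x x = 0"
    and chi_cubed: "x \<in> K \<Longrightarrow> y \<in> K \<Longrightarrow> x \<noteq> y \<Longrightarrow> \<chi> x y ^ 3 = 1"
    and chi_commute: "x \<in> K \<Longrightarrow> y \<in> K \<Longrightarrow> \<chi> x y = \<chi> y x"
    and sum_chi: "a \<in> K \<Longrightarrow> (\<Sum>x\<in>K. \<chi> x a) = 0"
    and autocorrelation: "a \<in> K \<Longrightarrow> b \<in> K \<Longrightarrow> a \<noteq> b \<Longrightarrow> (\<Sum>x\<in>K. \<chi> x a * cnj (\<chi> x b)) = -1"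
    and two_transitive: "\<lbrakk>x \<in> K; y \<in> K; x \<noteq> y; x' \<in> K; y' \<in> K; x' \<noteq> y'\<rbrakk> \<Longrightarrow>
      \<exists>\<phi> u. bij_betw \<phi> K K \<and> \<phi> x = x' \<and> \<phi> y = y' \<and> u \<noteq> 0 \<and>
        (\<forall>a\<in>K. \<forall>b\<in>K. \<chi> (\<phi> a) (\<phi> b) = u * \<chi> a b)"
begin

abbreviation q :: real where
  "q \<equiv> real (card K)"

abbreviation \<rho> :: "'a \<Rightarrow> 'a \<Rightarrow> 'a \<Rightarrow> real" where
  "\<rho> x y z \<equiv> of_bool (rainbow \<chi> x y z)"

lemma cmod_chi:
  assumes "x \<in> K" "y \<in> K"
  shows "cmod (\<chi> x y) = of_bool (x \<noteq> y)"
proof (cases "x = y")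
  case True
  then show ?thesis using assms chi_refl by simp
next
  case False
  then have "cmod (\<chi> x y) ^ 3 = 1" using chi_cubed[OF assms] by (metis norm_one norm_power)
  then show ?thesis using False power_eq_1_iff[of "cmod (\<chi> x y)" 3] by simp
qed

lemma sum_cmod_chi_square:
  assumes "A \<subseteq> K" "w \<in> K"
  shows "(\<Sum>x\<in>A. (cmod (\<chi> x w))\<^sup>2) = card (A - {w})"
proof -
  have "(\<Sum>x\<in>A. (cmod (\<chi> x w))\<^sup>2) = (\<Sum>x\<in>A. if x = w then 0 else 1)"
    using assms by (intro sum.cong) (auto simp: cmod_chi subset_iff)
  also have "\<dots> = card (A - {w})"
    using finite_subset[OF assms(1) finite_K] by (simp add: sum.If_cases set_diff_eq Int_def)
  finally show ?thesis .
qed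

lemma sum_chi_mult_cnj_chi:
  assumes "a \<in> K" "b \<in> K"
  shows "(\<Sum>x\<in>K. \<chi> x a * cnj (\<chi> x b)) = of_bool (a = b) * of_nat (card K) - 1"
proof (cases "a = b")
  case True
  have "(\<Sum>x\<in>K. \<chi> x a * cnj (\<chi> x a)) = of_real (\<Sum>x\<in>K. (cmod (\<chi> x a))\<^sup>2)"
    by (simp add: complex_norm_square[symmetric])
  also have "\<dots> = of_nat (card K) - 1"
    using assms finite_K card_gt_0_iff[of K] by (auto simp: sum_cmod_chi_square of_nat_diff)
  finally show ?thesis using True by simp
next
  case False
  then show ?thesis using autocorrelation assms by simp
qed

lemma sum_norm_square_le:
  fixes g :: "'a \<Rightarrow> complex"
  assumes "A \<subseteq> K"
  shows "(\<Sum>x\<in>K. (cmod (\<Sum>y\<in>A. \<chi> x y * g y))\<^sup>2) \<le> q * (\<Sum>y\<in>A. (cmod (g y))\<^sup>2)"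
proof -
  have fin: "finite A" using finite_subset[OF assms finite_K] .
  have "of_real (\<Sum>x\<in>K. (cmod (\<Sum>y\<in>A. \<chi> x y * g y))\<^sup>2)
      = (\<Sum>x\<in>K. (\<Sum>y\<in>A. \<chi> x y * g y) * cnj (\<Sum>y\<in>A. \<chi> x y * g y))"
    by (simp add: complex_norm_square[symmetric] del: cnj_sum)
  also have "\<dots> = (\<Sum>x\<in>K. \<Sum>y\<in>A. \<Sum>y'\<in>A. (\<chi> x y * cnj (\<chi> x y')) * (g y * cnj (g y')))"
    by (simp add: sum_product mult_ac)
  also have "\<dots> = (\<Sum>y\<in>A. \<Sum>y'\<in>A. \<Sum>x\<in>K. (\<chi> x y * cnj (\<chi> x y')) * (g y * cnj (g y')))"
    by (subst sum.swap) (intro sum.cong refl sum.swap)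
  also have "\<dots> = (\<Sum>y\<in>A. \<Sum>y'\<in>A. (of_bool (y = y') * of_nat (card K) - 1) * (g y * cnj (g y')))"
    using assms by (intro sum.cong refl) (simp add: sum_distrib_right[symmetric] sum_chi_mult_cnj_chi subset_iff)
  also have "\<dots> = (\<Sum>y\<in>A. of_nat (card K) * (g y * cnj (g y))) - (\<Sum>y\<in>A. g y) * cnj (\<Sum>y\<in>A. g y)"
    using fin by (simp add: algebra_simps sum_subtractf sum_product if_distrib[of "\<lambda>u. _ * u"] of_bool_def cong: if_cong)
  also have "\<dots> = of_real (q * (\<Sum>y\<in>A. (cmod (g y))\<^sup>2) - (cmod (\<Sum>y\<in>A. g y))\<^sup>2)"
    by (simp add: complex_norm_square[symmetric] sum_distrib_left del: cnj_sum)
  finally have "(\<Sum>x\<in>K. (cmod (\<Sum>y\<in>A. \<chi> x y * g y))\<^sup>2) = q * (\<Sum>y\<in>A. (cmod (g y))\<^sup>2) - (cmod (\<Sum>y\<in>A. g y))\<^sup>2"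
    by (simp only: of_real_eq_iff)
  then show ?thesis by simp
qed

lemma bilinear_bound:
  fixes f g :: "'a \<Rightarrow> complex"
  assumes "A \<subseteq> K" "B \<subseteq> K"
  shows "cmod (\<Sum>x\<in>A. \<Sum>y\<in>B. f x * (\<chi> x y * g y))
    \<le> sqrt q * sqrt (\<Sum>x\<in>A. (cmod (f x))\<^sup>2) * sqrt (\<Sum>y\<in>B. (cmod (g y))\<^sup>2)"
proof -
  have "(cmod (\<Sum>x\<in>A. f x * (\<Sum>y\<in>B. \<chi> x y * g y)))\<^sup>2
      \<le> (\<Sum>x\<in>A. (cmod (f x))\<^sup>2) * (\<Sum>x\<in>A. (cmod (\<Sum>y\<in>B. \<chi> x y * g y))\<^sup>2)"
    by (rule norm_sum_mult_le)
  also have "\<dots> \<le> (\<Sum>x\<in>A. (cmod (f x))\<^sup>2) * (\<Sum>x\<in>K. (cmod (\<Sum>y\<in>B. \<chi> x y * g y))\<^sup>2)"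
    using assms finite_K by (intro mult_left_mono sum_mono2 sum_nonneg) auto
  also have "\<dots> \<le> (\<Sum>x\<in>A. (cmod (f x))\<^sup>2) * (q * (\<Sum>y\<in>B. (cmod (g y))\<^sup>2))"
    using assms by (intro mult_left_mono sum_norm_square_le sum_nonneg) auto
  finally have "cmod (\<Sum>x\<in>A. f x * (\<Sum>y\<in>B. \<chi> x y * g y))
      \<le> sqrt ((\<Sum>x\<in>A. (cmod (f x))\<^sup>2) * (q * (\<Sum>y\<in>B. (cmod (g y))\<^sup>2)))"
    by (rule real_le_rsqrt)
  also have "\<dots> = sqrt q * sqrt (\<Sum>x\<in>A. (cmod (f x))\<^sup>2) * sqrt (\<Sum>y\<in>B. (cmod (g y))\<^sup>2)"
    by (simp add: real_sqrt_mult)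
  finally show ?thesis by (simp add: sum_distrib_left)
qed

definition triangle_sum :: "'a set \<Rightarrow> 'a set \<Rightarrow> 'a set \<Rightarrow> complex" where
  "triangle_sum U V W = (\<Sum>w\<in>W. \<Sum>u\<in>U. \<Sum>v\<in>V. \<chi> u v * \<chi> v w * \<chi> u w)"

definition path_sum :: "'a set \<Rightarrow> 'a set \<Rightarrow> 'a set \<Rightarrow> complex" where
  "path_sum U V W = (\<Sum>v\<in>V. (\<Sum>u\<in>U. \<chi> v u) * cnj (\<Sum>w\<in>W. \<chi> v w))"

lemma cmod_triangle_sum_le:
  assumes "U \<subseteq> K" "V \<subseteq> K" "W \<subseteq> K"
  shows "cmod (triangle_sum U V W) \<le> (\<Sum>w\<in>W. sqrt q * sqrt (card (U - {w})) * sqrt (card (V - {w})))"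
  unfolding triangle_sum_def
proof (rule order_trans[OF norm_sum], rule sum_mono)
  fix w assume "w \<in> W"
  then have "w \<in> K" using assms(3) by blast
  have "(\<Sum>u\<in>U. \<Sum>v\<in>V. \<chi> u v * \<chi> v w * \<chi> u w) = (\<Sum>u\<in>U. \<Sum>v\<in>V. \<chi> u w * (\<chi> u v * \<chi> v w))"
    by (simp add: mult_ac)
  then show "cmod (\<Sum>u\<in>U. \<Sum>v\<in>V. \<chi> u v * \<chi> v w * \<chi> u w)
      \<le> sqrt q * sqrt (card (U - {w})) * sqrt (card (V - {w}))"
    using bilinear_bound[OF assms(1,2), of "\<lambda>x. \<chi> x w" "\<lambda>x. \<chi> x w"]
      sum_cmod_chi_square[OF _ \<open>w \<in> K\<close>] assms(1,2) by simp
qed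

lemma cmod_path_sum_le:
  assumes "U \<subseteq> K" "V \<subseteq> K" "W \<subseteq> K"
  shows "cmod (path_sum U V W) \<le> q * sqrt (card U) * sqrt (card W)"
proof -
  have degrees: "(\<Sum>v\<in>V. (cmod (\<Sum>u\<in>A. \<chi> v u))\<^sup>2) \<le> q * card A" if "A \<subseteq> K" for A
  proof -
    have "(\<Sum>v\<in>V. (cmod (\<Sum>u\<in>A. \<chi> v u))\<^sup>2) \<le> (\<Sum>v\<in>K. (cmod (\<Sum>u\<in>A. \<chi> v u))\<^sup>2)"
      using assms finite_K by (intro sum_mono2) auto
    also have "\<dots> \<le> q * card A" using sum_norm_square_le[OF that, of "\<lambda>_. 1"] by simp
    finally show ?thesis .
  qed
  have "(cmod (path_sum U V W))\<^sup>2
      \<le> (\<Sum>v\<in>V. (cmod (\<Sum>u\<in>U. \<chi> v u))\<^sup>2) * (\<Sum>v\<in>V. (cmod (cnj (\<Sum>w\<in>W. \<chi> v w)))\<^sup>2)"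
    unfolding path_sum_def by (rule norm_sum_mult_le)
  also have "\<dots> \<le> (q * card U) * (q * card W)"
    using degrees[OF assms(1)] degrees[OF assms(3)]
    by (intro mult_mono) (auto intro!: sum_nonneg simp del: cnj_sum)
  finally have "cmod (path_sum U V W) \<le> sqrt ((q * card U) * (q * card W))"
    by (rule real_le_rsqrt)
  also have "\<dots> = q * sqrt (card U) * sqrt (card W)"
    by (simp add: real_sqrt_mult)
  finally show ?thesis .
qed

lemma path_sum_total: "V \<subseteq> K \<Longrightarrow> path_sum K V W = 0" "V \<subseteq> K \<Longrightarrow> path_sum W V K = 0"
proof -
  have "(\<Sum>x\<in>K. \<chi> a x) = 0" if "a \<in> K" for a
    using sum_chi[OF that] chi_commute that by (metis (no_types, lifting) sum.cong)
  then show "V \<subseteq> K \<Longrightarrow> path_sum K V W = 0" "V \<subseteq> K \<Longrightarrow> path_sum W V K = 0"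
    by (auto simp: path_sum_def subset_iff simp del: cnj_sum)
qed

definition rainbow_series :: "'a \<Rightarrow> 'a \<Rightarrow> 'a \<Rightarrow> real" where
  "rainbow_series x y z = 2 / 9 * (1 + 2 * Re (\<chi> x y * \<chi> y z * \<chi> x z)
     - Re (\<chi> x y * cnj (\<chi> y z)) - Re (\<chi> y z * cnj (\<chi> x z)) - Re (\<chi> x z * cnj (\<chi> x y)))"

lemma rainbow_series_eq:
  assumes "x \<in> K" "y \<in> K" "z \<in> K"
  shows "rainbow_series x y z = \<rho> x y z + 2 / 9 * of_bool (x = y \<and> y = z)"
proof -
  have Re_one: "Re (\<chi> a b * cnj (\<chi> a b)) = 1" if "a \<in> K" "b \<in> K" "a \<noteq> b" for a b
    using that by (simp add: complex_norm_square[symmetric] cmod_chi)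
  consider "x = y" "y = z" | "x = y" "y \<noteq> z" | "y = z" "x \<noteq> z" | "x = z" "x \<noteq> y" | "distinct [x, y, z]"
    by auto
  then show ?thesis
  proof cases
    case 5
    then show ?thesis
      using distinct_cube_roots_expansion[of "\<chi> x y" "\<chi> y z" "\<chi> x z"] chi_cubed assms
      by (simp add: rainbow_series_def rainbow_def)
  qed (use assms Re_one[of x y] Re_one[of y z] Re_one[of x z] chi_refl chi_commute[of x y] in
      \<open>simp_all add: rainbow_series_def rainbow_def del: times_complex.sel complex_mult_cnj\<close>)
qed

lemma sum_rainbow_series:
  assumes "U \<subseteq> K" "V \<subseteq> K" "W \<subseteq> K"
  shows "(\<Sum>u\<in>U. \<Sum>v\<in>V. \<Sum>w\<in>W. rainbow_series u v w) =
    2 / 9 * (real (card U) * card V * card W + 2 * Re (triangle_sum U V W)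
      - Re (path_sum U V W) - Re (path_sum V W U) - Re (path_sum W U V))"
proof -
  have "(\<Sum>u\<in>U. \<Sum>v\<in>V. \<Sum>w\<in>W. \<chi> u v * \<chi> v w * \<chi> u w) = (\<Sum>u\<in>U. \<Sum>w\<in>W. \<Sum>v\<in>V. \<chi> u v * \<chi> v w * \<chi> u w)"
    by (intro sum.cong refl sum.swap)
  also have "\<dots> = triangle_sum U V W" unfolding triangle_sum_def by (rule sum.swap)
  finally have triangle: "(\<Sum>u\<in>U. \<Sum>v\<in>V. \<Sum>w\<in>W. \<chi> u v * \<chi> v w * \<chi> u w) = triangle_sum U V W" .
  have "(\<Sum>u\<in>U. \<Sum>v\<in>V. \<Sum>w\<in>W. \<chi> u v * cnj (\<chi> v w)) = (\<Sum>v\<in>V. \<Sum>u\<in>U. \<Sum>w\<in>W. \<chi> v u * cnj (\<chi> v w))"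
    using assms chi_commute by (subst sum.swap) (auto intro!: sum.cong simp: subset_iff)
  then have path1: "(\<Sum>u\<in>U. \<Sum>v\<in>V. \<Sum>w\<in>W. \<chi> u v * cnj (\<chi> v w)) = path_sum U V W"
    by (simp add: path_sum_def sum_product)
  have "(\<Sum>u\<in>U. \<Sum>v\<in>V. \<Sum>w\<in>W. \<chi> v w * cnj (\<chi> u w)) = (\<Sum>u\<in>U. \<Sum>w\<in>W. \<Sum>v\<in>V. \<chi> w v * cnj (\<chi> w u))"
    using assms chi_commute by (subst (2) sum.swap) (auto intro!: sum.cong simp: subset_iff)
  also have "\<dots> = (\<Sum>w\<in>W. \<Sum>v\<in>V. \<Sum>u\<in>U. \<chi> w v * cnj (\<chi> w u))"
    by (subst sum.swap) (intro sum.cong refl sum.swap)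
  finally have path2: "(\<Sum>u\<in>U. \<Sum>v\<in>V. \<Sum>w\<in>W. \<chi> v w * cnj (\<chi> u w)) = path_sum V W U"
    by (simp add: path_sum_def sum_product)
  have path3: "(\<Sum>u\<in>U. \<Sum>v\<in>V. \<Sum>w\<in>W. \<chi> u w * cnj (\<chi> u v)) = path_sum W U V"
    by (simp add: path_sum_def sum_product) (intro sum.cong refl sum.swap)
  have "(\<Sum>u\<in>U. \<Sum>v\<in>V. \<Sum>w\<in>W. rainbow_series u v w) = 2 / 9 * ((\<Sum>u\<in>U. \<Sum>v\<in>V. \<Sum>w\<in>W. 1)
      + 2 * Re (\<Sum>u\<in>U. \<Sum>v\<in>V. \<Sum>w\<in>W. \<chi> u v * \<chi> v w * \<chi> u w)
      - Re (\<Sum>u\<in>U. \<Sum>v\<in>V. \<Sum>w\<in>W. \<chi> u v * cnj (\<chi> v w))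
      - Re (\<Sum>u\<in>U. \<Sum>v\<in>V. \<Sum>w\<in>W. \<chi> v w * cnj (\<chi> u w))
      - Re (\<Sum>u\<in>U. \<Sum>v\<in>V. \<Sum>w\<in>W. \<chi> u w * cnj (\<chi> u v)))"
    unfolding rainbow_series_def
    by (simp only: Re_sum sum_distrib_left sum.distrib sum_subtractf right_diff_distrib distrib_left mult_1_right)
  then show ?thesis unfolding triangle path1 path2 path3 by simp
qed

text \<open>
  Beside the main term \<open>n\<^sup>3\<close>, the triangle sum contributes at most \<open>2 n\<^sup>2 \<surd>q\<close>, each of the three path
  sums at most \<open>q n\<close>, and the diagonal at most \<open>n\<close>.
\<close>

lemma sum_rainbow_ge:
  assumes sub: "U \<subseteq> K" "V \<subseteq> K" "W \<subseteq> K" and card: "card U = n" "card V = n" "card W = n"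
  shows "2 / 9 * (n * ((real n - 3 * sqrt q) * (n + sqrt q) - 1)) \<le> (\<Sum>u\<in>U. \<Sum>v\<in>V. \<Sum>w\<in>W. \<rho> u v w)"
proof -
  note fin = finite_subset[OF sub(1) finite_K] finite_subset[OF sub(2) finite_K] finite_subset[OF sub(3) finite_K]
  define s where "s = sqrt q"
  have s: "s * s = q" "s \<ge> 0" by (simp_all add: s_def)
  have "cmod (triangle_sum U V W) \<le> (\<Sum>w\<in>W. s * sqrt n * sqrt n)"
    unfolding s_def
    by (rule order_trans[OF cmod_triangle_sum_le[OF sub]], intro sum_mono mult_mono)
      (use card card_Diff1_le[of U] card_Diff1_le[of V] in auto)
  then have triangle: "- Re (triangle_sum U V W) \<le> s * (real n * real n)"
    using complex_Re_le_cmod[of "- triangle_sum U V W"] card by (simp add: mult_ac)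
  have path: "Re (path_sum A B C) \<le> s * s * n"
    if "A \<subseteq> K" "B \<subseteq> K" "C \<subseteq> K" "card A = n" "card C = n" for A B C
    using complex_Re_le_cmod[of "path_sum A B C"] cmod_path_sum_le[OF that(1-3)] that(4,5) s by (simp add: mult.assoc)
  have "(\<Sum>u\<in>U. \<Sum>v\<in>V. \<Sum>w\<in>W. rainbow_series u v w)
      = (\<Sum>u\<in>U. \<Sum>v\<in>V. \<Sum>w\<in>W. \<rho> u v w + 2 / 9 * of_bool (u = v \<and> v = w))"
    using sub by (intro sum.cong refl rainbow_series_eq) auto
  also have "\<dots> = (\<Sum>u\<in>U. \<Sum>v\<in>V. \<Sum>w\<in>W. \<rho> u v w) + 2 / 9 * (\<Sum>u\<in>U. \<Sum>v\<in>V. \<Sum>w\<in>W. of_bool (u = v \<and> v = w))"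
    by (simp only: sum.distrib sum_distrib_left)
  also have "\<dots> \<le> (\<Sum>u\<in>U. \<Sum>v\<in>V. \<Sum>w\<in>W. \<rho> u v w) + 2 / 9 * n"
    using sum_triple_diagonal_le[of V W U] fin card by simp
  finally have count: "2 / 9 * (real n * n * n + 2 * Re (triangle_sum U V W)
      - Re (path_sum U V W) - Re (path_sum V W U) - Re (path_sum W U V)) - 2 / 9 * n
      \<le> (\<Sum>u\<in>U. \<Sum>v\<in>V. \<Sum>w\<in>W. \<rho> u v w)"
    by (simp only: sum_rainbow_series[OF sub] card diff_le_eq)
  have "real n * n * n - 2 * (s * (real n * n)) - 3 * (s * s * n)
      \<le> real n * n * n + 2 * Re (triangle_sum U V W)
        - Re (path_sum U V W) - Re (path_sum V W U) - Re (path_sum W U V)"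
    using triangle path[OF sub card(1,3)] path[OF sub(2,3,1) card(2,1)] path[OF sub(3,1,2) card(3,2)] by simp
  then have "2 / 9 * (real n * n * n - 2 * (s * (real n * n)) - 3 * (s * s * n)) - 2 / 9 * n
      \<le> (\<Sum>u\<in>U. \<Sum>v\<in>V. \<Sum>w\<in>W. \<rho> u v w)"
    by (intro order_trans[OF _ count]) simp
  then show ?thesis by (simp add: s_def[symmetric] algebra_simps)
qed

lemma rainbow_triple_exists:
  assumes sub: "U \<subseteq> K" "V \<subseteq> K" "W \<subseteq> K" and card: "card U = n" "card V = n" "card W = n"
    and large: "3 * sqrt q + 1 \<le> n"
  shows "\<exists>u\<in>U. \<exists>v\<in>V. \<exists>w\<in>W. rainbow \<chi> u v w"
proof (rule ccontr)
  define s where "s = sqrt q"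
  assume "\<not> ?thesis"
  then have "(\<Sum>u\<in>U. \<Sum>v\<in>V. \<Sum>w\<in>W. \<rho> u v w) = 0" by simp
  then have "n * ((real n - 3 * s) * (n + s) - 1) \<le> 0"
    using sum_rainbow_ge[OF sub card] by (simp add: s_def)
  moreover have "s \<ge> 0" "3 * s + 1 \<le> n" using large by (simp_all add: s_def)
  moreover from this have "real n \<ge> 1" by linarith
  ultimately have "(real n - 3 * s) * (n + s) \<le> 1" by (simp add: mult_le_0_iff)
  moreover have "1 * (n + s) \<le> (real n - 3 * s) * (n + s)"
    using \<open>s \<ge> 0\<close> \<open>3 * s + 1 \<le> n\<close> by (intro mult_right_mono) auto
  ultimately have "1 * (n + s) \<le> 1" by (rule order_trans[rotated])
  then have "n + s \<le> 1" by simp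
  moreover have "1 \<le> card K" using card_mono[OF finite_K sub(1)] card(1) \<open>real n \<ge> 1\<close> by simp
  then have "1 \<le> s" by (simp add: s_def)
  ultimately show False using \<open>real n \<ge> 1\<close> by linarith
qed

definition rainbow_automorphism :: "('a \<Rightarrow> 'a) \<Rightarrow> bool" where
  "rainbow_automorphism \<phi> \<longleftrightarrow> bij_betw \<phi> K K \<and>
     (\<forall>a\<in>K. \<forall>b\<in>K. \<forall>c\<in>K. rainbow \<chi> (\<phi> a) (\<phi> b) (\<phi> c) = rainbow \<chi> a b c)"

lemma rainbow_automorphism_two_transitive:
  assumes "x \<in> K" "y \<in> K" "x \<noteq> y" "x' \<in> K" "y' \<in> K" "x' \<noteq> y'"
  obtains \<phi> where "rainbow_automorphism \<phi>" "\<phi> x = x'" "\<phi> y = y'"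
proof -
  obtain \<phi> u where \<phi>: "bij_betw \<phi> K K" "\<phi> x = x'" "\<phi> y = y'" and u: "u \<noteq> 0"
    "\<And>a b. a \<in> K \<Longrightarrow> b \<in> K \<Longrightarrow> \<chi> (\<phi> a) (\<phi> b) = u * \<chi> a b"
    using two_transitive[OF assms] by blast
  have "rainbow_automorphism \<phi>"
    using \<phi>(1) u bij_betw_imp_inj_on[OF \<phi>(1)]
    by (simp add: rainbow_automorphism_def rainbow_def inj_on_eq_iff)
  then show thesis using that \<phi> by blast
qed

lemma invariant_off_diagonal_constant:
  assumes "\<And>\<phi> x y. rainbow_automorphism \<phi> \<Longrightarrow> x \<in> K \<Longrightarrow> y \<in> K \<Longrightarrow> f (\<phi> x) (\<phi> y) = f x y"
    and "x \<in> K" "y \<in> K" "x \<noteq> y" "x' \<in> K" "y' \<in> K" "x' \<noteq> y'"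
  shows "f x y = f x' y'"
  using rainbow_automorphism_two_transitive[OF assms(2-7)] assms(1)[of _ x y] assms(2,3) by metis

lemma sum_rainbow_automorphism:
  fixes f :: "'a \<Rightarrow> real"
  assumes "rainbow_automorphism \<phi>"
  shows "(\<Sum>x\<in>K. f (\<phi> x)) = (\<Sum>x\<in>K. f x)"
  using assms by (auto simp: rainbow_automorphism_def intro: sum.reindex_bij_betw)

lemma q_ge_2: "x \<in> K \<Longrightarrow> y \<in> K \<Longrightarrow> x \<noteq> y \<Longrightarrow> q \<ge> 2"
  using card_mono[of K "{x, y}"] finite_K by simp

definition rainbow_degree :: real where
  "rainbow_degree = (\<Sum>y\<in>K. \<Sum>z\<in>K. \<Sum>x\<in>K. \<rho> x y z) / (q * (q - 1))"

lemma sum_rainbow: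
  assumes "y \<in> K" "z \<in> K"
  shows "(\<Sum>x\<in>K. \<rho> x y z) = of_bool (y \<noteq> z) * rainbow_degree"
proof (cases "y = z")
  case True
  then show ?thesis by (simp add: rainbow_def)
next
  case False
  define f where "f y z = (\<Sum>x\<in>K. \<rho> x y z)" for y z
  have invariant: "f (\<phi> y) (\<phi> z) = f y z" if \<phi>: "rainbow_automorphism \<phi>" and "y \<in> K" "z \<in> K" for \<phi> y z
  proof -
    have "f (\<phi> y) (\<phi> z) = (\<Sum>x\<in>K. \<rho> (\<phi> x) (\<phi> y) (\<phi> z))"
      unfolding f_def by (rule sum_rainbow_automorphism[OF \<phi>, symmetric])
    then show ?thesis using that by (simp add: f_def rainbow_automorphism_def)
  qed
  have "(\<Sum>y\<in>K. \<Sum>z\<in>K. f y z) = q * 0 + q * (q - 1) * f y z"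
  proof (rule sum_off_diagonal[OF finite_K])
    show "f x x = 0" for x by (simp add: f_def rainbow_def)
    show "f y' z' = f y z" if "y' \<in> K" "z' \<in> K" "y' \<noteq> z'" for y' z'
      by (rule invariant_off_diagonal_constant[OF invariant]) (use that assms False in auto)
  qed
  moreover have "q * (q - 1) \<noteq> 0" using q_ge_2[OF assms False] by simp
  ultimately show ?thesis using False by (simp add: rainbow_degree_def f_def)
qed

lemma rainbow_degree_eq:
  assumes "w \<in> K"
  shows "(q - 1) * rainbow_degree = 2 / 9 * (q * q - 1 + 2 * Re (triangle_sum K K {w}))"
proof -
  have w: "{w} \<subseteq> K" using assms by simp
  have "(\<Sum>u\<in>K. \<Sum>v\<in>K. rainbow_series u v w) = 2 / 9 * (q * q + 2 * Re (triangle_sum K K {w}))"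
    using sum_rainbow_series[OF subset_refl subset_refl w] by (simp add: path_sum_total assms)
  moreover have "(\<Sum>u\<in>K. \<Sum>v\<in>K. rainbow_series u v w) = (\<Sum>v\<in>K. \<Sum>u\<in>K. \<rho> u v w + 2 / 9 * of_bool (u = v \<and> v = w))"
    using assms by (subst sum.swap) (intro sum.cong refl rainbow_series_eq)
  moreover have "\<dots> = (\<Sum>v\<in>K. rainbow_degree + (if v = w then 2 / 9 - rainbow_degree else 0))"
  proof (rule sum.cong[OF refl])
    fix v assume "v \<in> K"
    have "(\<Sum>u\<in>K. 2 / 9 * of_bool (u = v \<and> v = w)) = (\<Sum>u\<in>K. if u = v then 2 / 9 * of_bool (v = w) else (0::real))"
      by (intro sum.cong) auto
    also have "\<dots> = 2 / 9 * of_bool (v = w)" using finite_K \<open>v \<in> K\<close> by simp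
    finally show "(\<Sum>u\<in>K. \<rho> u v w + 2 / 9 * of_bool (u = v \<and> v = w))
        = rainbow_degree + (if v = w then 2 / 9 - rainbow_degree else 0)"
      using sum_rainbow[OF \<open>v \<in> K\<close> assms] by (simp only: sum.distrib) simp
  qed
  moreover have "\<dots> = (q - 1) * rainbow_degree + 2 / 9"
    using finite_K assms by (simp add: sum.distrib algebra_simps)
  ultimately show ?thesis by simp
qed

lemma rainbow_degree_bounds:
  assumes "card K \<ge> 2"
  shows "2 / 9 * (sqrt q - 1)\<^sup>2 \<le> rainbow_degree" "rainbow_degree \<le> 2 / 9 * (sqrt q + 1)\<^sup>2"
proof -
  define s where "s = sqrt q"
  have s: "s * s = q" by (simp add: s_def)
  obtain w where w: "w \<in> K" using assms by fastforce
  have pos: "q - 1 > 0" using assms by simp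
  have "cmod (triangle_sum K K {w}) \<le> s * (q - 1)"
    using cmod_triangle_sum_le[of K K "{w}"] w finite_K assms
    by (simp add: s_def mult.assoc card_Diff_singleton of_nat_diff)
  then have Re: "\<bar>Re (triangle_sum K K {w})\<bar> \<le> s * (q - 1)"
    using abs_Re_le_cmod order_trans by blast
  have "(q - 1) * (2 / 9 * (s - 1)\<^sup>2) = 2 / 9 * (q * q - 1 - 2 * (s * (q - 1)))"
    unfolding s[symmetric] by (simp add: field_simps power2_eq_square)
  also have "\<dots> \<le> (q - 1) * rainbow_degree" unfolding rainbow_degree_eq[OF w] using Re by simp
  finally show "2 / 9 * (sqrt q - 1)\<^sup>2 \<le> rainbow_degree"
    using pos by (simp only: mult_le_cancel_left_pos s_def)
  have "(q - 1) * rainbow_degree \<le> 2 / 9 * (q * q - 1 + 2 * (s * (q - 1)))"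
    unfolding rainbow_degree_eq[OF w] using Re by simp
  also have "\<dots> = (q - 1) * (2 / 9 * (s + 1)\<^sup>2)"
    unfolding s[symmetric] by (simp add: field_simps power2_eq_square)
  finally show "rainbow_degree \<le> 2 / 9 * (sqrt q + 1)\<^sup>2"
    using pos by (simp only: mult_le_cancel_left_pos s_def)
qed

lemma rainbow_rotate:
  assumes "x \<in> K" "y \<in> K" "z \<in> K"
  shows "rainbow \<chi> x y z = rainbow \<chi> y z x"
  using assms chi_commute[of x y] chi_commute[of x z] by (auto simp: rainbow_def)

lemma sum_rainbow_pairs:
  assumes "u \<in> K"
  shows "(\<Sum>e\<in>K \<times> K. \<rho> u (fst e) (snd e)) = (q - 1) * rainbow_degree"
proof -
  have "(\<Sum>b\<in>K. \<rho> u a b) = rainbow_degree - (if a = u then rainbow_degree else 0)" if "a \<in> K" for a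
  proof -
    have "(\<Sum>b\<in>K. \<rho> u a b) = (\<Sum>b\<in>K. \<rho> b u a)"
      by (intro sum.cong refl arg_cong[where f = of_bool] rainbow_rotate[symmetric]) (use that assms in auto)
    then show ?thesis using sum_rainbow[OF assms that] by auto
  qed
  then have "(\<Sum>a\<in>K. \<Sum>b\<in>K. \<rho> u a b) = (\<Sum>a\<in>K. rainbow_degree - (if a = u then rainbow_degree else 0))"
    by (rule sum.cong[OF refl])
  also have "\<dots> = (q - 1) * rainbow_degree"
    using finite_K assms by (simp add: sum_subtractf algebra_simps)
  finally show ?thesis by (simp add: sum.cartesian_product case_prod_unfold)
qed

text \<open>
  By two-transitivity the sum does not depend on the pair \<open>(u, v)\<close>, so it is found by summing over all pairs.
\<close>

lemma sum_rainbow_common_pairs: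
  assumes "u \<in> K" "v \<in> K" "u \<noteq> v"
  shows "(\<Sum>e\<in>K \<times> K. \<rho> u (fst e) (snd e) * \<rho> v (fst e) (snd e)) = rainbow_degree * (rainbow_degree - 1)"
proof -
  define D where "D = rainbow_degree"
  define P where "P x y = (\<Sum>a\<in>K. \<Sum>b\<in>K. \<rho> x a b * \<rho> y a b)" for x y
  have P_eq: "P x y = (\<Sum>e\<in>K \<times> K. \<rho> x (fst e) (snd e) * \<rho> y (fst e) (snd e))" for x y
    by (simp add: P_def sum.cartesian_product case_prod_unfold)
  have invariant: "P (\<phi> x) (\<phi> y) = P x y" if \<phi>: "rainbow_automorphism \<phi>" and "x \<in> K" "y \<in> K" for \<phi> x y
  proof -
    have "P (\<phi> x) (\<phi> y) = (\<Sum>a\<in>K. \<Sum>b\<in>K. \<rho> (\<phi> x) (\<phi> a) b * \<rho> (\<phi> y) (\<phi> a) b)"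
      unfolding P_def by (rule sum_rainbow_automorphism[OF \<phi>, symmetric])
    also have "\<dots> = (\<Sum>a\<in>K. \<Sum>b\<in>K. \<rho> (\<phi> x) (\<phi> a) (\<phi> b) * \<rho> (\<phi> y) (\<phi> a) (\<phi> b))"
      by (intro sum.cong refl sum_rainbow_automorphism[OF \<phi>, symmetric])
    finally show ?thesis using that by (simp add: P_def rainbow_automorphism_def)
  qed
  have "(\<Sum>x\<in>K. \<Sum>y\<in>K. P x y) = q * ((q - 1) * D) + q * (q - 1) * P u v"
  proof (rule sum_off_diagonal[OF finite_K])
    show "P x x = (q - 1) * D" if "x \<in> K" for x
      using sum_rainbow_pairs[OF that] by (simp add: P_eq D_def of_bool_conj[symmetric])
    show "P x y = P u v" if "x \<in> K" "y \<in> K" "x \<noteq> y" for x y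
      by (rule invariant_off_diagonal_constant[OF invariant]) (use that assms in auto)
  qed
  moreover have "(\<Sum>x\<in>K. \<Sum>y\<in>K. P x y) = (\<Sum>a\<in>K. \<Sum>b\<in>K. (\<Sum>x\<in>K. \<rho> x a b)\<^sup>2)"
    using sum_Gram[of "\<lambda>e x. \<rho> x (fst e) (snd e)" "K \<times> K" K] unfolding P_eq
    by (simp add: sum.cartesian_product case_prod_unfold)
  moreover have "\<dots> = q * 0 + q * (q - 1) * (D * D)"
    by (rule sum_off_diagonal[OF finite_K]) (simp_all add: sum_rainbow D_def power2_eq_square)
  ultimately have "q * (q - 1) * P u v = q * (q - 1) * (D * (D - 1))" by (simp add: algebra_simps)
  then show ?thesis using q_ge_2[OF assms] by (simp add: P_eq D_def)
qed

end

lemma mean_codegree_ge: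
  fixes s D :: real
  assumes s: "74 \<le> s" and D: "2 / 9 * (s - 1)\<^sup>2 \<le> D"
  shows "467 / 10000 * s\<^sup>2 \<le> ((s\<^sup>2 - 1) * D)\<^sup>2 / (s\<^sup>2) ^ 3"
proof -
  have s2: "5476 \<le> s\<^sup>2" using power_mono[OF s, of 2] by simp
  have "(73 / 74 * s)\<^sup>2 \<le> (s - 1)\<^sup>2" using s by (intro power_mono) auto
  then have "2 / 9 * (73 / 74)\<^sup>2 * s\<^sup>2 \<le> D" using D by (simp add: power_mult_distrib power_divide)
  moreover have "5475 / 5476 * s\<^sup>2 \<le> s\<^sup>2 - 1" using s2 by simp
  ultimately have "(5475 / 5476 * s\<^sup>2) * (2 / 9 * (73 / 74)\<^sup>2 * s\<^sup>2) \<le> (s\<^sup>2 - 1) * D"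
    using s2 by (intro mult_mono) auto
  then have "((5475 / 5476 * s\<^sup>2) * (2 / 9 * (73 / 74)\<^sup>2 * s\<^sup>2))\<^sup>2 / (s\<^sup>2) ^ 3 \<le> ((s\<^sup>2 - 1) * D)\<^sup>2 / (s\<^sup>2) ^ 3"
    using s2 by (intro divide_right_mono power_mono) auto
  moreover have "((5475 / 5476 * s\<^sup>2) * (2 / 9 * (73 / 74)\<^sup>2 * s\<^sup>2))\<^sup>2 / (s\<^sup>2) ^ 3
      = (5475 / 5476 * (2 / 9 * (73 / 74)\<^sup>2))\<^sup>2 * s\<^sup>2"
    using s by (simp add: power2_eq_square power3_eq_cube)
  moreover have "(467 / 10000 :: real) \<le> (5475 / 5476 * (2 / 9 * (73 / 74)\<^sup>2))\<^sup>2 "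
    by (simp add: power2_eq_square)
  then have "467 / 10000 * s\<^sup>2 \<le> (5475 / 5476 * (2 / 9 * (73 / 74)\<^sup>2))\<^sup>2 * s\<^sup>2"
    by (intro mult_right_mono) auto
  ultimately show ?thesis by (simp only: order_trans)
qed

lemma codegree_variance_le:
  fixes q D :: real
  assumes q: "4 \<le> q" and D: "0 \<le> D" "D \<le> q / 2"
  defines "\<mu> \<equiv> ((q - 1) * D)\<^sup>2 / q ^ 3"
  shows "q * ((q - 1) * D)\<^sup>2 + q * (q - 1) * (D * (D - 1))\<^sup>2 - \<mu>\<^sup>2 * q ^ 4 \<le> q ^ 4 * (\<mu> + 1)"
proof -
  have "(q - 1) ^ 4 - (q - 4) * q ^ 3 = 2 * (q - 1)\<^sup>2 + (4 * q\<^sup>2 - 1)"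
    by (simp add: power2_eq_square power3_eq_cube power4_eq_xxxx algebra_simps)
  moreover have "0 \<le> 4 * q\<^sup>2 - 1" using power_mono[of 4 q 2] q by simp
  ultimately have "(q - 4) * q ^ 3 \<le> (q - 1) ^ 4"
    by (metis diff_ge_0_iff_ge add_nonneg_nonneg mult_nonneg_nonneg zero_le_numeral zero_le_power2)
  then have "(q - 4) * q ^ 3 * D ^ 4 / q\<^sup>2 \<le> (q - 1) ^ 4 * D ^ 4 / q\<^sup>2"
    using q by (intro divide_right_mono mult_right_mono) auto
  also have "\<dots> = \<mu>\<^sup>2 * q ^ 4"
    unfolding \<mu>_def using q by (simp add: field_simps power2_eq_square power3_eq_cube power4_eq_xxxx)
  finally have mean_square: "(q - 4) * q * D ^ 4 \<le> \<mu>\<^sup>2 * q ^ 4"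
    using q by (simp add: power2_eq_square power3_eq_cube)
  have "D * D \<le> q / 2 * D" using D by (intro mult_right_mono) auto
  then have "q * (D - 1)\<^sup>2 - (q - 4) * (D * D) \<le> q" by (simp add: power2_eq_square algebra_simps)
  then have "q * (D * D) * (q * (D - 1)\<^sup>2 - (q - 4) * (D * D)) \<le> q * (D * D) * q"
    using q by (intro mult_left_mono) auto
  also have "\<dots> \<le> q * (q * q) * q" using q D by (intro mult_right_mono mult_left_mono mult_mono) auto
  also have "\<dots> = q ^ 4" by (simp add: power4_eq_xxxx)
  finally have pairs: "q * q * (D * (D - 1))\<^sup>2 - (q - 4) * q * D ^ 4 \<le> q ^ 4"
    by (simp add: power2_eq_square power4_eq_xxxx algebra_simps)
  have "q * (q - 1) * (D * (D - 1))\<^sup>2 - \<mu>\<^sup>2 * q ^ 4 \<le> q * q * (D * (D - 1))\<^sup>2 - (q - 4) * q * D ^ 4"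
    using mean_square q by (intro diff_mono mult_right_mono mult_left_mono) auto
  moreover have "q * ((q - 1) * D)\<^sup>2 = q ^ 4 * \<mu>"
    unfolding \<mu>_def using q by (simp add: field_simps power3_eq_cube power4_eq_xxxx)
  ultimately show ?thesis using pairs by (simp add: distrib_left)
qed

lemma mean_codegree_deviation:
  fixes s \<mu> :: real
  assumes s: "74 \<le> s" and \<mu>: "467 / 10000 * s\<^sup>2 \<le> \<mu>"
  shows "3 * s + 1 \<le> \<mu>" "3 * (\<mu> + 1) < (\<mu> - (3 * s + 1))\<^sup>2"
proof -
  define f where "f = \<mu> - (3 * s + 1)"
  have "74 * s \<le> s\<^sup>2" using s by (simp add: power2_eq_square)
  then have f: "11 / 25 * s \<le> f" using \<mu> s unfolding f_def by simp
  then show "3 * s + 1 \<le> \<mu>" using s unfolding f_def by simp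
  have "11 / 25 * s * (59 / 2) \<le> f * (f - 3)" using f s by (intro mult_mono) auto
  then have "3 * (\<mu> + 1) < f * f" using s unfolding f_def by (simp add: algebra_simps)
  then show "3 * (\<mu> + 1) < (\<mu> - (3 * s + 1))\<^sup>2" by (simp only: f_def power2_eq_square)
qed

context cubic_colouring
begin

definition common_completions :: "'a \<times> 'a \<Rightarrow> 'a \<times> 'a \<Rightarrow> 'a set" where
  "common_completions e e' = {u \<in> K. rainbow \<chi> u (fst e) (snd e) \<and> rainbow \<chi> u (fst e') (snd e')}"

definition codegree :: "'a \<times> 'a \<Rightarrow> 'a \<times> 'a \<Rightarrow> real" where
  "codegree e e' = card (common_completions e e')"

definition mean_codegree :: real where
  "mean_codegree = ((q - 1) * rainbow_degree)\<^sup>2 / q ^ 3"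

lemma codegree_eq: "codegree e e' = (\<Sum>u\<in>K. \<rho> u (fst e) (snd e) * \<rho> u (fst e') (snd e'))"
proof -
  have "(\<Sum>u\<in>K. \<rho> u (fst e) (snd e) * \<rho> u (fst e') (snd e'))
      = (\<Sum>u\<in>K. of_bool (u \<in> common_completions e e'))"
    by (intro sum.cong) (auto simp: common_completions_def)
  then show ?thesis
    using finite_K by (simp add: codegree_def common_completions_def Int_def)
qed

lemma sum_codegree:
  "(\<Sum>e\<in>K \<times> K. \<Sum>e'\<in>K \<times> K. codegree e e') = q * ((q - 1) * rainbow_degree)\<^sup>2"
  unfolding codegree_eq sum_Gram by (simp add: sum_rainbow_pairs)

lemma sum_codegree_square:
  "(\<Sum>e\<in>K \<times> K. \<Sum>e'\<in>K \<times> K. (codegree e e')\<^sup>2)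
    = q * ((q - 1) * rainbow_degree)\<^sup>2 + q * (q - 1) * (rainbow_degree * (rainbow_degree - 1))\<^sup>2"
proof -
  have diag: "(\<Sum>e\<in>K \<times> K. \<rho> u (fst e) (snd e) * \<rho> u (fst e) (snd e)) = (q - 1) * rainbow_degree"
    if "u \<in> K" for u
    using sum_rainbow_pairs[OF that] by (simp add: of_bool_conj[symmetric])
  show ?thesis
    unfolding codegree_eq
    by (rule trans[OF sum_Gram_square sum_off_diagonal[OF finite_K]])
      (simp_all only: diag sum_rainbow_common_pairs not_False_eq_True)
qed

lemma codegree_variance:
  assumes "q > 0"
  shows "(\<Sum>e\<in>K \<times> K. \<Sum>e'\<in>K \<times> K. (codegree e e' - mean_codegree)\<^sup>2)
    = q * ((q - 1) * rainbow_degree)\<^sup>2 + q * (q - 1) * (rainbow_degree * (rainbow_degree - 1))\<^sup>2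
      - mean_codegree\<^sup>2 * q ^ 4"
proof -
  have total: "(\<Sum>e\<in>K \<times> K. \<Sum>e'\<in>K \<times> K. codegree e e') = mean_codegree * q ^ 4"
    unfolding sum_codegree mean_codegree_def using assms
    by (simp add: field_simps power3_eq_cube power4_eq_xxxx)
  have "(\<Sum>e\<in>K \<times> K. \<Sum>e'\<in>K \<times> K. (codegree e e' - mean_codegree)\<^sup>2)
      = (\<Sum>e\<in>K \<times> K. \<Sum>e'\<in>K \<times> K. (codegree e e')\<^sup>2)
        - 2 * mean_codegree * (\<Sum>e\<in>K \<times> K. \<Sum>e'\<in>K \<times> K. codegree e e') + mean_codegree\<^sup>2 * q ^ 4"
    unfolding power2_diff
    by (simp add: sum.distrib sum_subtractf sum_distrib_left card_cartesian_product power4_eq_xxxx mult_ac)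
  then show ?thesis
    unfolding sum_codegree_square total by (simp add: power2_eq_square[of mean_codegree])
qed

lemma mean_codegree_large:
  assumes "card K \<ge> 5476"
  shows "3 * sqrt q + 1 \<le> mean_codegree" "3 * (mean_codegree + 1) < (mean_codegree - (3 * sqrt q + 1))\<^sup>2"
proof -
  define s where "s = sqrt q"
  have s: "74 \<le> s" "q = s\<^sup>2" using assms by (auto simp: s_def real_le_rsqrt)
  have "2 / 9 * (s - 1)\<^sup>2 \<le> rainbow_degree"
    using rainbow_degree_bounds(1) assms by (simp add: s_def)
  from mean_codegree_ge[OF s(1) this] have "467 / 10000 * s\<^sup>2 \<le> mean_codegree"
    by (simp add: mean_codegree_def s(2))
  from mean_codegree_deviation[OF s(1) this]
  show "3 * sqrt q + 1 \<le> mean_codegree" "3 * (mean_codegree + 1) < (mean_codegree - (3 * sqrt q + 1))\<^sup>2"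
    by (simp_all only: s_def)
qed

lemma codegree_variance_le_mean:
  assumes "card K \<ge> 5476"
  shows "(\<Sum>e\<in>K \<times> K. \<Sum>e'\<in>K \<times> K. (codegree e e' - mean_codegree)\<^sup>2) \<le> q ^ 4 * (mean_codegree + 1)"
proof -
  define s where "s = sqrt q"
  have s: "74 \<le> s" "q = s\<^sup>2" using assms by (auto simp: s_def real_le_rsqrt)
  have D: "2 / 9 * (s - 1)\<^sup>2 \<le> rainbow_degree" "rainbow_degree \<le> 2 / 9 * (s + 1)\<^sup>2"
    using rainbow_degree_bounds assms by (auto simp: s_def)
  have "74 * s \<le> s\<^sup>2" using s(1) by (simp add: power2_eq_square)
  then have "2 / 9 * (s + 1)\<^sup>2 \<le> s\<^sup>2 / 2" using s(1) by (simp add: power2_sum)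
  then have "rainbow_degree \<le> q / 2" using D(2) s(2) by simp
  moreover have "0 \<le> rainbow_degree" using D(1) by (rule order_trans[rotated]) simp
  ultimately show ?thesis
    using codegree_variance codegree_variance_le[of q rainbow_degree] assms
    by (simp add: mean_codegree_def)
qed

text \<open>
  The points \<open>a, b, a', b'\<close> form a quadrangle, and the common completions of its three pairs of opposite
  sides are the candidates for its diagonal points.
\<close>

lemma quadrangle_exists:
  assumes "card K \<ge> 5476"
  obtains a b a' b' where "a \<in> K" "b \<in> K" "a' \<in> K" "b' \<in> K"
    "3 * sqrt q + 1 \<le> codegree (a, b) (a', b')" "3 * sqrt q + 1 \<le> codegree (a, b') (a', b)"
    "3 * sqrt q + 1 \<le> codegree (a, a') (b, b')"
proof -
  define \<Omega> where "\<Omega> = (K \<times> K) \<times> (K \<times> K)"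
  define \<pi> where "\<pi> = (\<lambda>((a, b), (a', b')). ((a :: 'a, b' :: 'a), (a' :: 'a, b :: 'a)))"
  define \<pi>' where "\<pi>' = (\<lambda>((a, b), (a', b')). ((a :: 'a, a' :: 'a), (b :: 'a, b' :: 'a)))"
  define g where "g = (\<lambda>(e, e'). codegree e e')"
  define \<epsilon> where "\<epsilon> = mean_codegree - (3 * sqrt q + 1)"
  have perm: "bij_betw \<sigma> \<Omega> \<Omega>" if "\<sigma> \<in> {id, \<pi>, \<pi>'}" for \<sigma>
    by (rule bij_betw_byWitness[where f' = \<sigma>]) (use that in \<open>auto simp: \<Omega>_def \<pi>_def \<pi>'_def\<close>)
  have variance: "(\<Sum>\<omega>\<in>\<Omega>. (g \<omega> - mean_codegree)\<^sup>2) \<le> q ^ 4 * (mean_codegree + 1)"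
    using codegree_variance_le_mean[OF assms]
    by (simp add: \<Omega>_def g_def sum.cartesian_product case_prod_unfold)
  have "card {id, \<pi>, \<pi>'} \<le> 3" by (simp add: card_insert_if)
  then have "card {id, \<pi>, \<pi>'} * (\<Sum>\<omega>\<in>\<Omega>. (g \<omega> - mean_codegree)\<^sup>2) \<le> 3 * (q ^ 4 * (mean_codegree + 1))"
    using variance by (intro mult_mono) (simp_all add: sum_nonneg)
  also have "\<dots> = q ^ 4 * (3 * (mean_codegree + 1))" by (rule mult.left_commute)
  also have "\<dots> < q ^ 4 * \<epsilon>\<^sup>2"
    unfolding \<epsilon>_def using mean_codegree_large(2)[OF assms] assms by (intro mult_strict_left_mono) auto
  also have "q ^ 4 = card \<Omega>" by (simp add: \<Omega>_def card_cartesian_product power4_eq_xxxx)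
  finally have small: "card {id, \<pi>, \<pi>'} * (\<Sum>\<omega>\<in>\<Omega>. (g \<omega> - mean_codegree)\<^sup>2) < card \<Omega> * \<epsilon>\<^sup>2" .
  have "finite \<Omega>" "finite {id, \<pi>, \<pi>'}" "0 \<le> \<epsilon>"
    using finite_K mean_codegree_large(1)[OF assms] by (simp_all add: \<Omega>_def \<epsilon>_def)
  then obtain \<omega> where \<omega>: "\<omega> \<in> \<Omega>" "\<forall>\<sigma>\<in>{id, \<pi>, \<pi>'}. \<bar>g (\<sigma> \<omega>) - mean_codegree\<bar> < \<epsilon>"
    using Chebyshev_permuted[OF _ _ _ perm small] by blast
  obtain a b a' b' where "\<omega> = ((a, b), (a', b'))" by (metis prod.exhaust)
  then show thesis
    using \<omega> by (intro that[of a b a' b']) (auto simp: \<Omega>_def g_def \<pi>_def \<pi>'_def \<epsilon>_def)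
qed

theorem has_rainbow_fano_colouring:
  assumes "card K \<ge> 5476"
  shows "has_rainbow_fano K \<chi>"
proof -
  obtain a b a' b' where quadrangle: "a \<in> K" "b \<in> K" "a' \<in> K" "b' \<in> K"
    and codegrees: "3 * sqrt q + 1 \<le> codegree (a, b) (a', b')" "3 * sqrt q + 1 \<le> codegree (a, b') (a', b)"
      "3 * sqrt q + 1 \<le> codegree (a, a') (b, b')"
    using quadrangle_exists[OF assms] by blast
  define n where "n = nat \<lceil>3 * sqrt q + 1\<rceil>"
  have candidates: "\<exists>X \<subseteq> common_completions e e'. card X = n" if "3 * sqrt q + 1 \<le> codegree e e'" for e e'
  proof -
    have "n \<le> card (common_completions e e')"
      using that by (simp only: n_def codegree_def nat_ceiling_le_eq)
    then show ?thesis by (meson obtain_subset_with_card_n)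
  qed
  obtain U where U: "U \<subseteq> common_completions (a, b) (a', b')" "card U = n" using candidates[OF codegrees(1)] by blast
  obtain V where V: "V \<subseteq> common_completions (a, b') (a', b)" "card V = n" using candidates[OF codegrees(2)] by blast
  obtain W where W: "W \<subseteq> common_completions (a, a') (b, b')" "card W = n" using candidates[OF codegrees(3)] by blast
  have "U \<subseteq> K" "V \<subseteq> K" "W \<subseteq> K" using U V W by (auto simp: common_completions_def)
  moreover have "3 * sqrt q + 1 \<le> n" unfolding n_def by (rule real_nat_ceiling_ge)
  ultimately obtain u v w where "u \<in> U" "v \<in> V" "w \<in> W" and uvw: "rainbow \<chi> u v w"
    using rainbow_triple_exists U(2) V(2) W(2) by blast
  then have K: "u \<in> K" "v \<in> K" "w \<in> K"
    and lines: "rainbow \<chi> u a b" "rainbow \<chi> u a' b'" "rainbow \<chi> v a b'" "rainbow \<chi> v a' b" "rainbow \<chi> w a a'" "rainbow \<chi> w b b'"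
    using U V W by (auto simp: common_completions_def)
  have swap: "rainbow \<chi> x y z \<Longrightarrow> rainbow \<chi> x z y" if "x \<in> K" "y \<in> K" "z \<in> K" for x y z
    using chi_commute[OF that(2,3)] by (auto simp: rainbow_def)
  show ?thesis
  proof (rule has_rainbow_fanoI[of u v b' w a b a'])
    show "{u, v, b', w, a, b, a'} \<subseteq> K" using quadrangle K by simp
    show "rainbow \<chi> u v w" by (rule uvw)
    show "rainbow \<chi> w a a'" by (rule lines(5))
    show "rainbow \<chi> v b' a" using swap[OF _ _ _ lines(3)] quadrangle K by simp
    show "rainbow \<chi> b' w b" using rainbow_rotate[of b' w b] lines(6) quadrangle K by simp
    show "rainbow \<chi> a b u" using rainbow_rotate[of u a b] lines(1) quadrangle K by simp
    show "rainbow \<chi> b a' v" using rainbow_rotate[of v b a'] swap[OF _ _ _ lines(4)] quadrangle K by simp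
    show "rainbow \<chi> a' u b'" using rainbow_rotate[of a' u b'] swap[OF _ _ _ lines(2)] quadrangle K by simp
  qed
qed

end

section \<open>Cubic characters\<close>

context cubic_residue_field
begin

lemma noncube_exists: "\<exists>g \<in> carrier R. g \<noteq> \<zero> \<and> \<tau> g \<noteq> \<one>"
proof (rule ccontr)
  define m where "m = (order R - 1) div 3"
  assume "\<not> ?thesis"
  then have "carrier R - {\<zero>} \<subseteq> {x \<in> carrier R. x [^] m = \<one>}"
    by (auto simp: cubic_symbol_def m_def)
  then have "card (carrier R - {\<zero>}) \<le> card {x \<in> carrier R. x [^] m = \<one>}"
    using finite_carrier by (intro card_mono) auto
  also have "\<dots> \<le> m"
    using order_ge_7 by (intro num_roots_le_deg[OF finite_carrier]) (simp add: m_def)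
  finally have "order R - 1 \<le> m" using finite_carrier by (simp add: order_def card_Diff_singleton)
  then show False using order_ge_7 by (simp add: m_def)
qed

lemma sum_shift:
  fixes f :: "'a \<Rightarrow> 'b::comm_monoid_add"
  assumes "a \<in> carrier R"
  shows "(\<Sum>x\<in>carrier R. f (x \<ominus> a)) = (\<Sum>x\<in>carrier R. f x)"
proof (rule sum.reindex_bij_betw)
  show "bij_betw (\<lambda>x. x \<ominus> a) (carrier R) (carrier R)"
    by (rule bij_betw_byWitness[where f' = "\<lambda>x. x \<oplus> a"])
      (use assms in \<open>auto simp: minus_eq a_assoc l_neg r_neg\<close>)
qed

lemma mult_inv_mult_inv:
  assumes "a \<in> Units R" "b \<in> Units R"
  shows "a \<otimes> inv (a \<otimes> inv b) = b"
proof -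
  have closed: "a \<in> carrier R" "b \<in> carrier R" "inv a \<in> carrier R" "inv b \<in> carrier R"
    using assms by (simp_all add: Units_closed)
  have "inv b \<otimes> (b \<otimes> inv a) = inv a" using closed assms by (simp add: m_assoc[symmetric])
  then have "inv (a \<otimes> inv b) = b \<otimes> inv a"
    using assms closed by (intro comm_inv_char) (simp_all add: m_assoc)
  then show ?thesis using closed assms m_lcomm[of a b "inv a"] by simp
qed

lemma affine_map_exists:
  assumes xy: "x \<in> carrier R" "y \<in> carrier R" "x \<noteq> y" "x' \<in> carrier R" "y' \<in> carrier R" "x' \<noteq> y'"
  obtains \<phi> \<alpha> where "bij_betw \<phi> (carrier R) (carrier R)" "\<phi> x = x'" "\<phi> y = y'" "\<alpha> \<in> Units R"
    "\<And>a b. a \<in> carrier R \<Longrightarrow> b \<in> carrier R \<Longrightarrow> \<phi> a \<ominus> \<phi> b = \<alpha> \<otimes> (a \<ominus> b)"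
proof -
  have units: "y \<ominus> x \<in> Units R" "y' \<ominus> x' \<in> Units R" using xy by (auto simp: field_Units)
  define \<alpha> where "\<alpha> = (y' \<ominus> x') \<otimes> inv (y \<ominus> x)"
  define \<phi> where "\<phi> z = x' \<oplus> \<alpha> \<otimes> (z \<ominus> x)" for z
  have unit: "\<alpha> \<in> Units R" using units by (simp add: \<alpha>_def)
  then have closed: "\<alpha> \<in> carrier R" "inv \<alpha> \<in> carrier R" by (simp_all add: Units_closed)
  have "\<alpha> \<otimes> (y \<ominus> x) = y' \<ominus> x'" using units xy by (simp add: \<alpha>_def m_assoc)
  then have "\<phi> y = y'" unfolding \<phi>_def using xy by (simp only:) algebra
  moreover have "\<phi> x = x'" using xy closed by (simp add: \<phi>_def minus_eq r_neg)
  moreover have diff: "\<phi> a \<ominus> \<phi> b = \<alpha> \<otimes> (a \<ominus> b)" if "a \<in> carrier R" "b \<in> carrier R" for a b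
    unfolding \<phi>_def using that xy(1,4) closed(1) by algebra
  moreover have "bij_betw \<phi> (carrier R) (carrier R)"
  proof -
    have "inj_on \<phi> (carrier R)"
    proof (rule inj_onI)
      fix a b assume ab: "a \<in> carrier R" "b \<in> carrier R" "\<phi> a = \<phi> b"
      have "\<phi> b \<in> carrier R" using ab xy closed by (simp add: \<phi>_def)
      then have "\<alpha> \<otimes> (a \<ominus> b) = \<zero>" using diff[OF ab(1,2)] ab(3) by (simp add: minus_eq r_neg)
      then show "a = b" using unit ab(1,2) integral[of \<alpha> "a \<ominus> b"] closed by (auto simp: field_Units)
    qed
    moreover have "\<phi> ` carrier R \<subseteq> carrier R" using xy closed by (auto simp: \<phi>_def)
    ultimately show ?thesis using finite_carrier by (simp add: bij_betw_def endo_inj_surj)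
  qed
  ultimately show thesis using that unit by blast
qed

context
  fixes g assumes g: "g \<in> carrier R" "g \<noteq> \<zero>" "\<tau> g \<noteq> \<one>"
begin

definition cubic_character :: "'a \<Rightarrow> complex" ("\<psi>") where
  "\<psi> x = (if x = \<zero> then 0 else if \<tau> x = \<one> then 1 else if \<tau> x = \<tau> g then omega else cnj omega)"

lemma primitive_cube_root:
  "\<tau> g \<otimes> \<tau> g \<noteq> \<one>" "\<tau> g \<otimes> \<tau> g \<noteq> \<tau> g" "\<tau> g \<otimes> (\<tau> g \<otimes> \<tau> g) = \<one>"
proof -
  have closed: "\<tau> g \<in> carrier R" using g by simp
  show cube: "\<tau> g \<otimes> (\<tau> g \<otimes> \<tau> g) = \<one>"
    using cubic_symbol_cubed[OF g(1,2)] closed by (simp add: numeral_3_eq_3 m_assoc)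
  show "\<tau> g \<otimes> \<tau> g \<noteq> \<one>" using cube closed g(3) by auto
  show "\<tau> g \<otimes> \<tau> g \<noteq> \<tau> g" using cube closed g(3) by auto
qed

lemma cubic_symbol_cases:
  assumes "x \<in> carrier R" "x \<noteq> \<zero>"
  shows "\<tau> x = \<one> \<or> \<tau> x = \<tau> g \<or> \<tau> x = \<tau> g \<otimes> \<tau> g"
proof -
  have "{\<one>, \<tau> g, \<tau> g \<otimes> \<tau> g} = \<tau> ` (carrier R - {\<zero>})"
  proof (rule card_seteq)
    have "\<tau> \<one> \<in> \<tau> ` (carrier R - {\<zero>})" "\<tau> g \<in> \<tau> ` (carrier R - {\<zero>})" "\<tau> (g \<otimes> g) \<in> \<tau> ` (carrier R - {\<zero>})"
      by (intro imageI, use g integral[of g g] in auto)+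
    then show "{\<one>, \<tau> g, \<tau> g \<otimes> \<tau> g} \<subseteq> \<tau> ` (carrier R - {\<zero>})" using g by (simp add: cubic_symbol_mult)
    show "card (\<tau> ` (carrier R - {\<zero>})) \<le> card {\<one>, \<tau> g, \<tau> g \<otimes> \<tau> g}"
      using card_cubic_symbols_le g(3) primitive_cube_root(1,2) by (simp add: eq_commute)
  qed (use finite_carrier in simp)
  then show ?thesis using assms by blast
qed

lemma cubic_character_cases:
  assumes "x \<in> carrier R" "x \<noteq> \<zero>"
  obtains "\<tau> x = \<one>" "\<psi> x = 1" | "\<tau> x = \<tau> g" "\<psi> x = omega" | "\<tau> x = \<tau> g \<otimes> \<tau> g" "\<psi> x = cnj omega"
  using cubic_symbol_cases[OF assms] assms g(3) primitive_cube_root(1,2)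
  by (auto simp: cubic_character_def)

lemma cubic_character_zero [simp]: "\<psi> \<zero> = 0"
  by (simp add: cubic_character_def)

lemma cubic_character_one [simp]: "\<psi> \<one> = 1"
  by (simp add: cubic_character_def)

lemma cubic_character_cubed: "x \<in> carrier R \<Longrightarrow> x \<noteq> \<zero> \<Longrightarrow> \<psi> x ^ 3 = 1"
  unfolding cube_roots_of_unity by (erule cubic_character_cases) auto

lemma cubic_character_minus: "x \<in> carrier R \<Longrightarrow> \<psi> (\<ominus> x) = \<psi> x"
  by (auto simp: cubic_character_def cubic_symbol_minus)

lemma cubic_character_eq_iff:
  assumes "x \<in> carrier R" "x \<noteq> \<zero>" "y \<in> carrier R" "y \<noteq> \<zero>"
  shows "\<psi> x = \<psi> y \<longleftrightarrow> \<tau> x = \<tau> y"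
proof -
  note distinct = g(3) primitive_cube_root(1,2) omega_neq
  show ?thesis
    by (rule cubic_character_cases[OF assms(1,2)]; rule cubic_character_cases[OF assms(3,4)])
      (simp_all add: distinct distinct[symmetric])
qed

lemma cubic_character_mult:
  assumes "x \<in> carrier R" "y \<in> carrier R"
  shows "\<psi> (x \<otimes> y) = \<psi> x * \<psi> y"
proof (cases "x = \<zero> \<or> y = \<zero>")
  case True
  then show ?thesis using assms by auto
next
  case False
  then have nonzero: "x \<noteq> \<zero>" "y \<noteq> \<zero>" "x \<otimes> y \<noteq> \<zero>" using assms integral by blast+
  have closed: "\<tau> g \<in> carrier R" using g by simp
  have fourth: "\<tau> g \<otimes> \<tau> g \<otimes> (\<tau> g \<otimes> \<tau> g) = \<tau> g" "\<tau> g \<otimes> \<tau> g \<otimes> \<tau> g = \<one>"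
    using primitive_cube_root(3) closed by (simp_all add: m_assoc)
  note distinct = g(3) primitive_cube_root(1,2)
  show ?thesis
    by (rule cubic_character_cases[OF assms(1) nonzero(1)]; rule cubic_character_cases[OF assms(2) nonzero(2)])
      (simp_all add: cubic_character_def[of "x \<otimes> y"] nonzero cubic_symbol_mult assms closed primitive_cube_root(3)
        fourth distinct distinct[symmetric] omega_mult)
qed

lemma sum_cubic_character: "(\<Sum>x\<in>carrier R. \<psi> x) = 0"
proof -
  have unit: "g \<in> Units R" using g by (simp add: field_Units)
  have "bij_betw (\<lambda>x. g \<otimes> x) (carrier R) (carrier R)"
    by (rule bij_betw_byWitness[where f' = "\<lambda>x. inv g \<otimes> x"]) (use g unit in \<open>auto simp: m_assoc[symmetric]\<close>)
  then have "(\<Sum>x\<in>carrier R. \<psi> x) = (\<Sum>x\<in>carrier R. \<psi> (g \<otimes> x))"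
    using sum.reindex_bij_betw[of "\<lambda>x. g \<otimes> x" "carrier R" "carrier R" \<psi>] by simp
  also have "\<dots> = \<psi> g * (\<Sum>x\<in>carrier R. \<psi> x)"
    using g by (simp add: cubic_character_mult sum_distrib_left)
  finally have "(\<psi> g - 1) * (\<Sum>x\<in>carrier R. \<psi> x) = 0" by (simp add: algebra_simps)
  moreover have "\<psi> g \<noteq> 1" using g omega_neq by (simp add: cubic_character_def)
  ultimately show ?thesis by simp
qed

lemma cubic_character_mult_cnj:
  assumes "s \<in> carrier R" "t \<in> carrier R" "t \<noteq> \<zero>"
  shows "\<psi> s * cnj (\<psi> t) = \<psi> (s \<otimes> inv t)"
proof -
  have t: "t \<in> Units R" using assms by (simp add: field_Units)
  have "\<psi> t * cnj (\<psi> t) = 1"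
    by (rule cubic_character_cases[OF assms(2,3)]) (simp_all add: omega_mult)
  moreover have "\<psi> (s \<otimes> inv t) * \<psi> t = \<psi> s"
    using assms t by (simp add: cubic_character_mult[symmetric] m_assoc)
  ultimately show ?thesis by (metis mult.assoc mult.right_neutral)
qed

lemma sum_cubic_character_shifted_inverse:
  assumes e: "e \<in> Units R"
  shows "(\<Sum>t\<in>carrier R - {\<zero>}. \<psi> (\<one> \<oplus> e \<otimes> inv t)) = -1"
proof -
  note closed = Units_closed[OF e]
  have cancel: "\<one> \<oplus> s \<ominus> \<one> = s" "\<one> \<oplus> (s \<ominus> \<one>) = s" if "s \<in> carrier R" for s
    using that by algebra+
  have "(\<Sum>t\<in>carrier R - {\<zero>}. \<psi> (\<one> \<oplus> e \<otimes> inv t)) = (\<Sum>x\<in>carrier R - {\<one>}. \<psi> x)"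
  proof (rule sum.reindex_bij_witness[where i = "\<lambda>s. e \<otimes> inv (s \<ominus> \<one>)" and j = "\<lambda>t. \<one> \<oplus> e \<otimes> inv t"])
    fix t assume "t \<in> carrier R - {\<zero>}"
    then have t: "t \<in> Units R" by (simp add: field_Units)
    then show "e \<otimes> inv ((\<one> \<oplus> e \<otimes> inv t) \<ominus> \<one>) = t"
      using e closed by (simp add: cancel mult_inv_mult_inv)
    have "e \<otimes> inv t \<in> Units R" using e t by simp
    then show "\<one> \<oplus> e \<otimes> inv t \<in> carrier R - {\<one>}" by (auto simp: field_Units)
  next
    fix s assume s: "s \<in> carrier R - {\<one>}"
    then have unit: "s \<ominus> \<one> \<in> Units R" by (simp add: field_Units)
    then show "\<one> \<oplus> e \<otimes> inv (e \<otimes> inv (s \<ominus> \<one>)) = s"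
      using e s by (simp add: cancel mult_inv_mult_inv)
    have "e \<otimes> inv (s \<ominus> \<one>) \<in> Units R" using e unit by simp
    then show "e \<otimes> inv (s \<ominus> \<one>) \<in> carrier R - {\<zero>}" by (simp add: field_Units)
  qed simp
  also have "\<dots> = -1"
    using sum_cubic_character sum_diff1[OF finite_carrier, of \<psi> \<one>] by simp
  finally show ?thesis .
qed

lemma cubic_character_autocorrelation:
  assumes ab: "a \<in> carrier R" "b \<in> carrier R" "a \<noteq> b"
  shows "(\<Sum>x\<in>carrier R. \<psi> (x \<ominus> a) * cnj (\<psi> (x \<ominus> b))) = -1"
proof -
  define e where "e = b \<ominus> a"
  have e: "e \<in> Units R" "e \<in> carrier R" using ab by (auto simp: e_def field_Units)
  have shift: "x \<ominus> a = (x \<ominus> b) \<oplus> e" if "x \<in> carrier R" for x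
    unfolding e_def using that ab(1,2) by algebra
  have "(\<Sum>x\<in>carrier R. \<psi> (x \<ominus> a) * cnj (\<psi> (x \<ominus> b))) = (\<Sum>t\<in>carrier R. \<psi> (t \<oplus> e) * cnj (\<psi> t))"
    using sum_shift[OF ab(2), of "\<lambda>t. \<psi> (t \<oplus> e) * cnj (\<psi> t)"] by (simp add: shift cong: sum.cong)
  also have "\<dots> = (\<Sum>t\<in>carrier R - {\<zero>}. \<psi> (t \<oplus> e) * cnj (\<psi> t))"
    using finite_carrier by (intro sum.mono_neutral_right) auto
  also have "\<dots> = (\<Sum>t\<in>carrier R - {\<zero>}. \<psi> (\<one> \<oplus> e \<otimes> inv t))"
  proof (intro sum.cong refl)
    fix t assume t: "t \<in> carrier R - {\<zero>}"
    then have "t \<in> Units R" by (simp add: field_Units)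
    then show "\<psi> (t \<oplus> e) * cnj (\<psi> t) = \<psi> (\<one> \<oplus> e \<otimes> inv t)"
      using t e by (simp add: cubic_character_mult_cnj l_distr)
  qed
  also have "\<dots> = -1" by (rule sum_cubic_character_shifted_inverse[OF e(1)])
  finally show ?thesis .
qed

lemma cubic_colouring_cubic_character: "cubic_colouring (carrier R) (\<lambda>x y. \<psi> (x \<ominus> y))"
proof
  show "\<psi> (x \<ominus> y) ^ 3 = 1" if "x \<in> carrier R" "y \<in> carrier R" "x \<noteq> y" for x y
    using cubic_character_cubed[of "x \<ominus> y"] that by simp
  show "\<psi> (x \<ominus> y) = \<psi> (y \<ominus> x)" if "x \<in> carrier R" "y \<in> carrier R" for x y
    using cubic_character_minus[of "y \<ominus> x"] that by (simp add: minus_eq minus_add a_comm)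
  show "\<exists>\<phi> u. bij_betw \<phi> (carrier R) (carrier R) \<and> \<phi> x = x' \<and> \<phi> y = y' \<and> u \<noteq> 0 \<and>
      (\<forall>a\<in>carrier R. \<forall>b\<in>carrier R. \<psi> (\<phi> a \<ominus> \<phi> b) = u * \<psi> (a \<ominus> b))"
    if xy: "x \<in> carrier R" "y \<in> carrier R" "x \<noteq> y" "x' \<in> carrier R" "y' \<in> carrier R" "x' \<noteq> y'" for x y x' y'
  proof -
    obtain \<phi> \<alpha> where \<phi>: "bij_betw \<phi> (carrier R) (carrier R)" "\<phi> x = x'" "\<phi> y = y'" and \<alpha>: "\<alpha> \<in> Units R"
      and diff: "\<And>a b. a \<in> carrier R \<Longrightarrow> b \<in> carrier R \<Longrightarrow> \<phi> a \<ominus> \<phi> b = \<alpha> \<otimes> (a \<ominus> b)"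
      using affine_map_exists[OF xy] by blast
    have "\<psi> \<alpha> \<noteq> 0" using cubic_character_cubed[of \<alpha>] \<alpha> by (auto simp: field_Units)
    moreover have "\<forall>a\<in>carrier R. \<forall>b\<in>carrier R. \<psi> (\<phi> a \<ominus> \<phi> b) = \<psi> \<alpha> * \<psi> (a \<ominus> b)"
      using \<alpha> by (simp add: diff cubic_character_mult Units_closed)
    ultimately show ?thesis using \<phi> by blast
  qed
qed (use finite_carrier sum_cubic_character sum_shift[of _ \<psi>] cubic_character_autocorrelation
    in \<open>simp_all add: minus_eq r_neg\<close>)

end

theorem has_rainbow_fano_large:
  assumes "order R \<ge> 5476"
  shows "has_rainbow_fano (carrier R) \<delta>"
proof -
  obtain g where g: "g \<in> carrier R" "g \<noteq> \<zero>" "\<tau> g \<noteq> \<one>" using noncube_exists by blast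
  define \<chi> where "\<chi> x y = cubic_character g (x \<ominus> y)" for x y
  interpret cubic_colouring "carrier R" \<chi>
    using cubic_colouring_cubic_character[OF g] by (simp add: \<chi>_def[abs_def])
  have "\<chi> x y = \<chi> x' y' \<longleftrightarrow> \<delta> x y = \<delta> x' y'"
    if "x \<in> carrier R" "y \<in> carrier R" "x \<noteq> y" "x' \<in> carrier R" "y' \<in> carrier R" "x' \<noteq> y'" for x y x' y'
    using that cubic_character_eq_iff[OF g] by (simp add: \<chi>_def difference_symbol_def)
  then have "rainbow \<chi> x y z \<Longrightarrow> rainbow \<delta> x y z"
    if "x \<in> carrier R" "y \<in> carrier R" "z \<in> carrier R" for x y z
    using that by (auto simp: rainbow_def)
  moreover obtain P where "range P \<subseteq> carrier R" "rainbow_fano \<chi> P"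
    using has_rainbow_fano_colouring assms unfolding has_rainbow_fano_def order_def by blast
  ultimately show ?thesis
    unfolding has_rainbow_fano_def rainbow_fano_def by (metis range_subsetD)
qed

end

section \<open>Quadratic and cubic extensions of prime fields\<close>

text \<open>
  A commutative ring modulo the congruence whose normal forms are computed by \<open>r\<close>.
\<close>

definition reduction_ring :: "('a::ab_group_add \<Rightarrow> 'a) \<Rightarrow> ('a \<Rightarrow> 'a \<Rightarrow> 'a) \<Rightarrow> 'a \<Rightarrow> 'a ring" where
  "reduction_ring r m e = \<lparr>carrier = range r, monoid.mult = (\<lambda>x y. r (m x y)), one = r e,
     zero = r 0, add = (\<lambda>x y. r (x + y))\<rparr>"

locale ring_reduction =
  fixes r :: "'a::ab_group_add \<Rightarrow> 'a" and m :: "'a \<Rightarrow> 'a \<Rightarrow> 'a" and e :: 'a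
  assumes mult_commute: "m x y = m y x"
    and mult_assoc: "m (m x y) z = m x (m y z)"
    and mult_distrib: "m (x + y) z = m x z + m y z"
    and mult_one: "m e x = x"
    and red_add: "r (r x + y) = r (x + y)"
    and red_mult: "r (m (r x) y) = r (m x y)"
begin

abbreviation Q :: "'a ring" where
  "Q \<equiv> reduction_ring r m e"

lemma red_idem [simp]: "r (r x) = r x"
  using red_add[of x 0] by simp

lemma red_add_right: "r (x + r y) = r (x + y)"
  using red_add[of y x] by (simp add: add.commute)

lemma red_mult_right: "r (m x (r y)) = r (m x y)"
  using red_mult[of y x] by (simp add: mult_commute)

lemma reduction_ring_simps:
  "carrier Q = range r" "x \<otimes>\<^bsub>Q\<^esub> y = r (m x y)" "x \<oplus>\<^bsub>Q\<^esub> y = r (x + y)" "\<one>\<^bsub>Q\<^esub> = r e" "\<zero>\<^bsub>Q\<^esub> = r 0"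
  by (simp_all add: reduction_ring_def)

lemma red_carrier: "x \<in> carrier Q \<Longrightarrow> r x = x"
  by (auto simp: reduction_ring_simps)

lemma reduction_ring_cring: "cring Q"
proof (rule cringI)
  note simps [simp] = reduction_ring_simps red_add red_add_right red_mult red_mult_right
  show "abelian_group Q"
  proof (rule abelian_groupI)
    show "\<exists>y\<in>carrier Q. y \<oplus>\<^bsub>Q\<^esub> x = \<zero>\<^bsub>Q\<^esub>" if "x \<in> carrier Q" for x
      using that by (intro bexI[of _ "r (- x)"]) auto
  qed (auto simp: add.assoc, auto simp: add.commute)
  show "Group.comm_monoid Q"
  proof (rule Group.comm_monoidI)
    show "x \<otimes>\<^bsub>Q\<^esub> y \<otimes>\<^bsub>Q\<^esub> z = x \<otimes>\<^bsub>Q\<^esub> (y \<otimes>\<^bsub>Q\<^esub> z)" for x y z by (simp add: mult_assoc)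
    show "x \<otimes>\<^bsub>Q\<^esub> y = y \<otimes>\<^bsub>Q\<^esub> x" for x y by (simp add: mult_commute[of x y])
  qed (auto simp: mult_one)
qed (auto simp: reduction_ring_simps red_add red_add_right red_mult mult_distrib)

lemma reduction_ring_minus:
  assumes "x \<in> carrier Q" "y \<in> carrier Q"
  shows "x \<ominus>\<^bsub>Q\<^esub> y = r (x - y)"
proof -
  interpret cring Q by (rule reduction_ring_cring)
  have "r (x - y) \<oplus>\<^bsub>Q\<^esub> y = x"
    using red_add[of "x - y" y] red_carrier[OF assms(1)] by (simp add: reduction_ring_simps)
  moreover have "r (x - y) \<in> carrier Q" by (simp add: reduction_ring_simps)
  ultimately show ?thesis
    using add.inv_solve_right[of "r (x - y)" x y] assms by (simp add: minus_eq)
qed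

lemma reduction_ring_field:
  assumes "r 0 \<noteq> r e" and inv: "\<And>x. r x = x \<Longrightarrow> x \<noteq> r 0 \<Longrightarrow> \<exists>y. r (m x y) = r e"
  shows "field Q"
proof (rule cring.cring_fieldI2[OF reduction_ring_cring])
  fix x assume x: "x \<in> carrier Q" "x \<noteq> \<zero>\<^bsub>Q\<^esub>"
  then obtain y where "r (m x y) = r e"
    using inv[OF red_carrier] by (auto simp: reduction_ring_simps)
  then show "\<exists>y\<in>carrier Q. x \<otimes>\<^bsub>Q\<^esub> y = \<one>\<^bsub>Q\<^esub>"
    by (intro bexI[of _ "r y"]) (simp_all add: reduction_ring_simps red_mult_right)
qed (use assms(1) in \<open>simp add: reduction_ring_simps\<close>)

end

lemma prime_inverse_mod:
  fixes N :: int
  assumes "prime p" "\<not> p dvd N"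
  obtains n where "(N * n) mod p = 1"
proof -
  have "coprime N p" using prime_imp_coprime[OF assms] by (simp add: coprime_commute)
  then obtain n where "[N * n = 1] (mod p)" using cong_solve_coprime_int by blast
  then show thesis using that assms(1) prime_gt_1_int[of p] by (auto simp: cong_def)
qed

text \<open>\<open>(a, b)\<close> stands for \<open>a + b t\<close> with \<open>t\<^sup>2 = w\<close>, and below \<open>(a, b, c)\<close> for \<open>a + b t + c t\<^sup>2\<close> with \<open>t\<^sup>3 = w\<close>.\<close>

fun quad_red :: "int \<Rightarrow> int \<times> int \<Rightarrow> int \<times> int" where
  "quad_red p (a, b) = (a mod p, b mod p)"

fun quad_mult :: "int \<Rightarrow> int \<times> int \<Rightarrow> int \<times> int \<Rightarrow> int \<times> int" where
  "quad_mult w (a, b) (c, d) = (a * c + b * (w * d), a * d + b * c)"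

abbreviation quadratic_ring :: "int \<Rightarrow> int \<Rightarrow> (int \<times> int) ring" where
  "quadratic_ring p w \<equiv> reduction_ring (quad_red p) (quad_mult w) (1, 0)"

interpretation quad: ring_reduction "quad_red p" "quad_mult w" "(1, 0)" for p w
proof
  show "quad_red p (quad_mult w (quad_red p x) y) = quad_red p (quad_mult w x y)" for x y
    by (cases x; cases y) (auto intro!: mod_add_cong simp: mod_simps)
qed (auto simp: mod_simps algebra_simps)

lemma quadratic_ring_carrier: "p > 0 \<Longrightarrow> carrier (quadratic_ring p w) = {0..<p} \<times> {0..<p}"
  unfolding quad.reduction_ring_simps
proof (intro equalityI subsetI)
  fix x assume "x \<in> {0..<p} \<times> {0..<p}"
  then have "x = quad_red p x" by (cases x) simp
  then show "x \<in> range (quad_red p)" by (rule range_eqI)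
qed auto

lemma quadratic_ring_order:
  assumes "p > 0"
  shows "order (quadratic_ring (int p) w) = p * p"
  using assms by (simp add: order_def quadratic_ring_carrier card_cartesian_product)

definition anisotropic_mod :: "int \<Rightarrow> int \<Rightarrow> bool" where
  "anisotropic_mod p w \<longleftrightarrow> (\<forall>a b. p dvd a * a - w * (b * b) \<longrightarrow> p dvd a \<and> p dvd b)"

lemma quadratic_ring_field:
  assumes p: "prime p" and w: "anisotropic_mod p w"
  shows "field (quadratic_ring p w)"
proof (rule quad.reduction_ring_field)
  have "p > 1" using p prime_gt_1_int by blast
  then show "quad_red p 0 \<noteq> quad_red p (1, 0)" by (simp add: zero_prod_def)
  fix x assume x: "quad_red p x = x" "x \<noteq> quad_red p 0"
  obtain a b where ab: "x = (a, b)" by (cases x)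
  have "\<not> (p dvd a \<and> p dvd b)" using x ab by (auto simp: zero_prod_def)
  then have "\<not> p dvd a * a - w * (b * b)" using w unfolding anisotropic_mod_def by blast
  then obtain n where "((a * a - w * (b * b)) * n) mod p = 1" using prime_inverse_mod[OF p] by blast
  then have "quad_red p (quad_mult w x (a * n, - b * n)) = quad_red p (1, 0)"
    using \<open>p > 1\<close> by (simp add: ab algebra_simps)
  then show "\<exists>y. quad_red p (quad_mult w x y) = quad_red p (1, 0)" by blast
qed

lemma quadratic_ring_cubic_residue_field:
  fixes p :: nat
  assumes p: "prime p" "p * p mod 6 = 1" and w: "anisotropic_mod (int p) w"
  shows "cubic_residue_field (quadratic_ring (int p) w)"
proof -
  have "p > 0" using p(1) prime_gt_0_nat by blast
  then show ?thesis
    using p w quadratic_ring_field[of "int p" w]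
    by (simp add: cubic_residue_field_def cubic_residue_field_axioms_def quadratic_ring_order quadratic_ring_carrier)
qed

fun cub_red :: "int \<Rightarrow> int \<times> int \<times> int \<Rightarrow> int \<times> int \<times> int" where
  "cub_red p (a, b, c) = (a mod p, b mod p, c mod p)"

fun cub_mult :: "int \<Rightarrow> int \<times> int \<times> int \<Rightarrow> int \<times> int \<times> int \<Rightarrow> int \<times> int \<times> int" where
  "cub_mult w (a, b, c) (d, e, f) =
     (a * d + b * (w * f) + c * (w * e), a * e + b * d + c * (w * f), a * f + b * e + c * d)"

abbreviation cubic_ring :: "int \<Rightarrow> int \<Rightarrow> (int \<times> int \<times> int) ring" where
  "cubic_ring p w \<equiv> reduction_ring (cub_red p) (cub_mult w) (1, 0, 0)"

interpretation cub: ring_reduction "cub_red p" "cub_mult w" "(1, 0, 0)" for p w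
proof
  show "cub_red p (cub_mult w (cub_red p x) y) = cub_red p (cub_mult w x y)" for x y
    by (cases x; cases y) (auto intro!: mod_add_cong simp: mod_simps)
qed (auto simp: mod_simps algebra_simps)

lemma cubic_ring_carrier: "p > 0 \<Longrightarrow> carrier (cubic_ring p w) = {0..<p} \<times> {0..<p} \<times> {0..<p}"
  unfolding cub.reduction_ring_simps
proof (intro equalityI subsetI)
  fix x assume "x \<in> {0..<p} \<times> {0..<p} \<times> {0..<p}"
  then have "x = cub_red p x" by (cases x) simp
  then show "x \<in> range (cub_red p)" by (rule range_eqI)
qed auto

fun cub_norm :: "int \<Rightarrow> int \<times> int \<times> int \<Rightarrow> int" where
  "cub_norm w (a, b, c) = a * (a * a) + w * (b * (b * b)) + w * (w * (c * (c * c))) - 3 * (w * (a * (b * c)))"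

lemma cubic_ring_field:
  assumes p: "prime p"
    and norm: "\<And>x. x \<in> carrier (cubic_ring p w) \<Longrightarrow> p dvd cub_norm w x \<Longrightarrow> x = (0, 0, 0)"
  shows "field (cubic_ring p w)"
proof (rule cub.reduction_ring_field)
  have "p > 1" using p prime_gt_1_int by blast
  then show "cub_red p 0 \<noteq> cub_red p (1, 0, 0)" by (simp add: zero_prod_def)
  fix x assume x: "cub_red p x = x" "x \<noteq> cub_red p 0"
  obtain a b c where abc: "x = (a, b, c)" by (cases x)
  have "x \<in> carrier (cubic_ring p w)" using x(1) unfolding cub.reduction_ring_simps by (metis rangeI)
  then have "\<not> p dvd cub_norm w x" using norm[of x] x(2) by (auto simp: zero_prod_def)
  then obtain n where n: "(cub_norm w x * n) mod p = 1" using prime_inverse_mod[OF p] by blast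
  let ?y = "((a * a - w * (b * c)) * n, (w * (c * c) - a * b) * n, (b * b - a * c) * n)"
  have "cub_mult w x ?y = (cub_norm w x * n, 0, 0)" by (simp add: abc algebra_simps)
  then have "cub_red p (cub_mult w x ?y) = cub_red p (1, 0, 0)" using n \<open>p > 1\<close> by simp
  then show "\<exists>y. cub_red p (cub_mult w x y) = cub_red p (1, 0, 0)" by blast
qed

lemma cong_cube_cancel:
  fixes p :: nat and x y :: int
  assumes p: "prime p" "p mod 6 = 5" and "[x ^ 3 = y ^ 3] (mod p)"
  shows "[x = y] (mod p)"
proof -
  obtain j where j: "p = 6 * j + 5" using p(2) by (metis mult.commute div_mult_mod_eq)
  have root: "[(z ^ 3) ^ (4 * j + 3) = z] (mod p)" for z :: int
  proof (cases "int p dvd z")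
    case True
    then show ?thesis by (simp add: cong_iff_dvd_diff dvd_power_same dvd_trans[OF _ dvd_power])
  next
    case False
    then have "coprime z (int p)" using prime_imp_coprime[of "int p" z] p(1) by (simp add: coprime_commute)
    moreover have "residues (int p)" using prime_gt_1_nat[OF p(1)] by (simp add: residues_def)
    ultimately have "[z ^ (p - 1) = 1] (mod p)"
      using residues.euler_theorem totient_prime[OF p(1)] by fastforce
    then have "[(z ^ (p - 1)) ^ 2 * z = 1 ^ 2 * z] (mod p)" by (intro cong_mult cong_pow cong_refl)
    moreover have "(p - 1) * 2 + 1 = 3 * (4 * j + 3)" by (simp add: j)
    then have "(z ^ (p - 1)) ^ 2 * z = (z ^ 3) ^ (4 * j + 3)" by (metis power_mult power_add power_one_right)
    ultimately show ?thesis by simp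
  qed
  have "[(x ^ 3) ^ (4 * j + 3) = (y ^ 3) ^ (4 * j + 3)] (mod p)" using assms(3) by (rule cong_pow)
  then show ?thesis using root cong_sym cong_trans by meson
qed

text \<open>If \<open>a\<^sup>2 = -3 b\<^sup>2\<close> then \<open>(a - b)\<^sup>3 = (2 b)\<^sup>3\<close>, and cubing is injective modulo \<open>p\<close>.\<close>

lemma anisotropic_mod_minus_three:
  fixes p :: nat
  assumes p: "prime p" "p mod 6 = 5"
  shows "anisotropic_mod (int p) (-3)"
  unfolding anisotropic_mod_def
proof (intro allI impI)
  fix a b assume d: "int p dvd a * a - (-3) * (b * b)"
  have "(a - b) ^ 3 - (2 * b) ^ 3 = (a * a - (-3) * (b * b)) * (a - 3 * b)"
    by (simp add: power3_eq_cube algebra_simps)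
  then have "[(a - b) ^ 3 = (2 * b) ^ 3] (mod p)" using d by (simp add: cong_iff_dvd_diff)
  then have "[a - b = 2 * b] (mod p)" by (rule cong_cube_cancel[OF p])
  then have a: "int p dvd a - 3 * b" by (simp add: cong_iff_dvd_diff algebra_simps)
  have "int p dvd (a * a - (-3) * (b * b)) - (a - 3 * b) * (a + 3 * b)"
    by (rule dvd_diff[OF d dvd_mult2[OF a]])
  then have "int p dvd int 12 * (b * b)" by (simp add: algebra_simps)
  moreover have "\<not> p dvd 12"
  proof
    assume "p dvd 12"
    then have "p \<le> 12" by (rule dvd_imp_le) simp
    then have "p = 5 \<or> p = 11" using p(2) by presburger
    then show False using \<open>p dvd 12\<close> by auto
  qed
  ultimately have b: "int p dvd b"
    using p(1) by (metis int_dvd_int_iff prime_dvd_mult_iff prime_nat_int_transfer)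
  then have "int p dvd (a - 3 * b) + 3 * b" using a by (intro dvd_add) auto
  then show "int p dvd a \<and> int p dvd b" using b by simp
qed

lemma anisotropic_mod_13: "anisotropic_mod 13 2"
  unfolding anisotropic_mod_def
proof (intro allI impI)
  have residues: "\<forall>x\<in>set [0..12]. \<forall>y\<in>set [0..12]. (x * x - 2 * (y * y)) mod 13 = (0 :: int) \<longrightarrow> x = 0 \<and> y = 0"
    by code_simp
  fix a b :: int assume d: "13 dvd a * a - 2 * (b * b)"
  have "(a mod 13 * (a mod 13) - 2 * (b mod 13 * (b mod 13))) mod 13 = (a * a - 2 * (b * b)) mod 13"
    by (intro mod_diff_cong mod_mult_cong) simp_all
  also have "\<dots> = 0" using d by (rule dvd_imp_mod_0)
  finally have norm: "(a mod 13 * (a mod 13) - 2 * (b mod 13 * (b mod 13))) mod 13 = 0" .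
  have "a mod 13 \<in> set [0..12]" "b mod 13 \<in> set [0..12]" by simp_all
  then have "a mod 13 = 0 \<and> b mod 13 = 0" using norm by (rule residues[THEN bspec, THEN bspec, THEN mp])
  then show "13 dvd a \<and> 13 dvd b" by auto
qed

lemma cub_norm_13:
  assumes "x \<in> carrier (cubic_ring 13 2)" "13 dvd cub_norm 2 x"
  shows "x = (0, 0, 0)"
proof -
  have residues: "\<forall>a\<in>set [0..12]. \<forall>b\<in>set [0..12]. \<forall>c\<in>set [0..12].
      cub_norm 2 (a, b, c) mod 13 = 0 \<longrightarrow> a = 0 \<and> b = 0 \<and> c = 0"
    by code_simp
  obtain a b c where abc: "x = (a, b, c)" by (cases x)
  then have "a \<in> set [0..12]" "b \<in> set [0..12]" "c \<in> set [0..12]"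
    using assms(1) by (simp_all add: cubic_ring_carrier)
  moreover have "cub_norm 2 (a, b, c) mod 13 = 0" using assms(2) abc by (simp only: dvd_imp_mod_0)
  ultimately have "a = 0 \<and> b = 0 \<and> c = 0" by (rule residues[THEN bspec, THEN bspec, THEN bspec, THEN mp])
  then show ?thesis using abc by simp
qed

lemma cubic_ring_13:
  "cubic_residue_field (cubic_ring 13 2)" "order (cubic_ring 13 2) = 2197"
proof -
  show order: "order (cubic_ring 13 2) = 2197"
    by (simp add: order_def cubic_ring_carrier card_cartesian_product)
  have "field (cubic_ring 13 2)" by (rule cubic_ring_field[OF _ cub_norm_13]) simp_all
  then show "cubic_residue_field (cubic_ring 13 2)"
    using order by (simp add: cubic_residue_field_def cubic_residue_field_axioms_def cubic_ring_carrier)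
qed

section \<open>Explicit rainbow Fano planes over small fields\<close>

fun fast_pow :: "('a \<Rightarrow> 'a \<Rightarrow> 'a) \<Rightarrow> 'a \<Rightarrow> int \<Rightarrow> 'a" where
  "fast_pow f x n = (if n \<le> 1 then x else
     let y = fast_pow f x (n div 2); z = f y y in if even n then z else f z x)"

declare fast_pow.simps [simp del]

lemma nat_halves:
  assumes "1 < (n::int)"
  obtains k where "k \<ge> 1" "n div 2 = int k" "nat n = k + k + (if even n then 0 else 1)"
proof (rule that[of "nat (n div 2)"])
  have "int (nat n) = int (nat (n div 2) + nat (n div 2) + (if even n then 0 else 1))"
    using assms by (cases "even n") (simp_all, presburger+)
  then show "nat n = nat (n div 2) + nat (n div 2) + (if even n then 0 else 1)" by (simp only: of_nat_eq_iff)
qed (use assms in auto)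

lemma fast_pow_eq:
  assumes "n \<ge> 1" and "pw 1 = x" and "\<And>i j. f (pw i) (pw j) = pw (i + j)"
  shows "fast_pow f x n = pw (nat n)"
  using assms
proof (induction f x n rule: fast_pow.induct)
  case (1 f x n)
  show ?case
  proof (cases "n = 1")
    case True
    then show ?thesis using "1.prems"(2) by (simp add: fast_pow.simps)
  next
    case False
    then have "1 < n" using "1.prems"(1) by simp
    then obtain k where k: "k \<ge> 1" "n div 2 = int k" "nat n = k + k + (if even n then 0 else 1)"
      by (rule nat_halves)
    have "fast_pow f x (int k) = pw k" using "1.IH" "1.prems" \<open>1 < n\<close> k by simp
    then show ?thesis
      using \<open>1 < n\<close> "1.prems"(2,3) unfolding k(3)
      by (auto simp: fast_pow.simps[of f x n] Let_def k(2) simp del: One_nat_def)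
  qed
qed

lemma fast_pow_mod:
  assumes "n \<ge> 1"
  shows "fast_pow (\<lambda>x y. x * y mod p) (x mod p) n = x ^ nat n mod (p :: int)"
  by (rule fast_pow_eq[OF assms]) (simp_all add: power_add mod_mult_eq)

fun rainbow_points :: "('a \<Rightarrow> 'a \<Rightarrow> 'b) \<Rightarrow> 'a list \<Rightarrow> bool" where
  "rainbow_points f [a0, a1, a2, a3, a4, a5, a6] \<longleftrightarrow>
     rainbow f a0 a1 a3 \<and> rainbow f a1 a2 a4 \<and> rainbow f a2 a3 a5 \<and> rainbow f a3 a4 a6 \<and>
     rainbow f a4 a5 a0 \<and> rainbow f a5 a6 a1 \<and> rainbow f a6 a0 a2"
| "rainbow_points f _ \<longleftrightarrow> False"

text \<open>
  Powers of the primes in the list \<open>t\<close> are tabulated, so that by multiplicativity a smooth \<open>d\<close> costs no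
  further exponentiation.
\<close>

function smooth_pow :: "int \<Rightarrow> int \<Rightarrow> (int \<times> int) list \<Rightarrow> int \<Rightarrow> int" where
  "smooth_pow p n [] d = (if d = 1 then 1 else fast_pow (\<lambda>x y. x * y mod p) (d mod p) n)"
| "smooth_pow p n ((l, s) # t) d =
     (if 0 < d \<and> 1 < l \<and> l dvd d then s * smooth_pow p n ((l, s) # t) (d div l) mod p
      else smooth_pow p n t d)"
  by pat_completeness auto
termination
  by (relation "measures [\<lambda>(p, n, t, d). length t, \<lambda>(p, n, t, d). nat d]")
    (auto simp: nat_less_iff int_div_less_self)

declare smooth_pow.simps(2) [simp del]

fun pow_table :: "int \<Rightarrow> int \<Rightarrow> int list \<Rightarrow> (int \<times> int) list" where
  "pow_table p n [] = []"
| "pow_table p n (l # ls) = (l, fast_pow (\<lambda>x y. x * y mod p) (l mod p) n) # pow_table p n ls"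

text \<open>
  \<open>prime_symbol\<close> and \<open>extension_symbol\<close> are constants because \<open>code_simp\<close> also rewrites under
  abstractions, where it would expand the powers symbolically.
\<close>

definition prime_symbol :: "int \<Rightarrow> int \<Rightarrow> (int \<times> int) list \<Rightarrow> int \<Rightarrow> int \<Rightarrow> int" where
  "prime_symbol p n t x y = smooth_pow p n t \<bar>x - y\<bar>"

definition prime_field_check :: "int list \<Rightarrow> int \<Rightarrow> bool" where
  "prime_field_check xs p \<longleftrightarrow> list_all (\<lambda>a. 0 \<le> a \<and> a < p) xs \<and>
     (let n = (p - 1) div 3 in rainbow_points (prime_symbol p n (pow_table p n [2, 3, 5, 7])) xs)"

definition prime_field_table :: "(int list \<times> int list) list" where
  "prime_field_table = [
    ([0,18,3,6,8,12,9], [37,139,163,181,241,313,337,349,379,409,421,541,571,607,631,751,859,877,937,1033,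
      1087,1123,1171,1291,1297,1447,1453,1483,1693,1741,1747,2011,2161,2239,2311,2371,2473,2539,2647,2677,
      2707,2719,2857,3169,3361,3433,3511,3547,3559,3571,3613,3637,3727,3877,3919,3931,4003,4021,4111,4201,
      4219,4261,4297,4357,4363,4441,4507,4561,4603,4801,4831,4861,4903,4987,4999,5023,5107,5119,5431]),
    ([0,27,15,6,24,18,20], [331,373,463,487,673,769,829,883,1153,1201,1489,1663,2053,2137,2551,2683,2887,
      3037,3301,3583,3709,4231,4591,4621,5443]),
    ([0,60,10,24,30,18,25], [229,271,277,283,547,613,1249,1801,2113,2143,2689,3253,3331,3391,3739,4423,4567,
      5011,5437,5449]),
    ([0,24,6,4,9,12,8], [97,709,1129,1279,1381,1567,1951,2083,2293,2437,2557,2797,3121,3307,3469,3643,3673,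
      3769]),
    ([0,55,20,22,30,25,50], [73,397,661,1051,1789,2131,3049,3109,3187,3217,3319,3943,4483,4957,4969,5209]),
    ([0,33,6,3,8,18,30], [151,619,787,991,1009,1621,2713,3019,3067,3907,4933]),
    ([0,32,4,7,25,16,28], [199,211,823,1063,1429,2521,2593,3313,4243,4723]),
    ([0,50,21,15,25,35,29], [1093,1609,1759,2179,2221,2251,2803,3181,3343,3967]),
    ([0,30,6,9,10,24,15], [223,811,1579,1777,2767,2833,3259,4027,5347]),
    ([0,28,7,4,10,16,12], [1213,1237,1993,2377,2659,3691,4159,4813,5407]),
    ([0,50,9,5,25,45,41], [433,1999,2017,2917,3271,4051,5167,5419]),
    ([0,27,12,6,18,21,20], [103,967,1321,1669,1879,4093,4993]),
    ([0,49,22,24,28,33,42], [739,1699,1753,1831,4549,4657,4909]),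
    ([0,54,4,24,36,20,9], [193,577,757,1783,3529,4099]),
    ([0,41,1,10,37,5,25], [109,157,601,3163,4129,4759]), ([0,28,3,9,24,19,4], [907,1231,2467,3697,4789]),
    ([0,35,7,15,30,21,23], [457,3061,3541,4519,4663]), ([0,51,1,3,7,35,18], [61,2029,2617,3847,4951]),
    ([0,44,19,3,25,41,22], [439,499,3373,3607,4339]), ([0,28,4,7,10,16,19], [1987,2503,3793,4273]),
    ([0,50,7,15,25,35,43], [307,919,3889,4057]), ([0,60,5,25,35,32,11], [1867,2851,3079,5077]),
    ([0,34,3,14,31,20,17], [3001,4513,4651,5413]), ([0,30,5,14,18,10,9], [2731,4153,4597]),
    ([0,28,1,4,18,8,10], [43,1069,2089]), ([0,56,14,8,50,15,20], [1861,2389,5179]),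
    ([0,50,3,5,14,10,4], [1873,4327,4447]), ([0,50,8,1,49,21,29], [1117,1549,3499]),
    ([0,42,9,18,15,35,11], [1471,2269,3229]), ([0,26,7,6,19,20,13], [727,4783,5227]),
    ([0,57,8,21,39,12,26], [1459,2749,2953]), ([0,42,2,17,13,15,28], [1531,2341,4177]),
    ([0,52,1,19,28,18,36], [733,1327,3457]), ([0,54,14,17,20,34,37], [1021,2383,5323]),
    ([0,17,2,6,3,7,10], [19,3517]), ([0,56,6,10,15,7,8], [4639,5281]), ([0,58,18,21,30,28,42], [691,2791]),
    ([0,32,4,10,24,11,14], [67,2281]), ([0,40,16,1,35,28,25], [523,1543]),
    ([0,57,1,25,37,50,10], [2347,3463]), ([0,57,8,12,36,15,49], [1303,3853]),
    ([0,54,3,12,48,19,20], [127,1627]), ([0,60,4,3,59,52,58], [79,1039]),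
    ([0,38,2,14,7,19,26], [1423,3733]), ([0,56,12,10,21,33,35], [643,5197]),
    ([0,58,1,28,57,50,29], [997,1597]), ([0,48,6,23,43,18,40], [367,1723]),
    ([0,58,9,10,35,38,29], [2203,2671]), ([0,51,23,9,45,47,32], [853,1657]),
    ([0,54,2,26,7,48,13], [2287,5233]), ([0,6,1,2,5,4,3], [7]), ([0,24,4,9,12,10,14], [31]),
    ([0,56,7,6,9,49,31], [3631]), ([0,56,1,6,7,25,26], [1399]), ([0,50,7,8,43,42,25], [4729]),
    ([0,54,7,5,42,50,25], [1933]), ([0,31,1,3,5,24,18], [3823]), ([0,44,13,14,19,24,25], [2971]),
    ([0,51,31,6,34,49,40], [5101]), ([0,47,4,15,22,40,11], [5059]), ([0,46,13,2,39,44,33], [5113])]"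


lemma rainbow_points_has_rainbow_fano:
  assumes "set xs \<subseteq> K" and eq: "\<And>x y. x \<in> K \<Longrightarrow> y \<in> K \<Longrightarrow> f x y = g x y" and "rainbow_points f xs"
  shows "has_rainbow_fano K g"
proof -
  obtain a0 a1 a2 a3 a4 a5 a6 where xs: "xs = [a0, a1, a2, a3, a4, a5, a6]"
    using assms(3) by (cases "(f, xs)" rule: rainbow_points.cases) auto
  have "rainbow f x y z \<Longrightarrow> rainbow g x y z" if "x \<in> K" "y \<in> K" "z \<in> K" for x y z
    using that by (simp add: rainbow_def eq)
  then show ?thesis
    using assms(1,3) by (intro has_rainbow_fanoI[of a0 a1 a2 a3 a4 a5 a6]) (simp_all add: xs)
qed

lemma smooth_pow_eq:
  assumes "\<forall>(l, s)\<in>set t. s = l ^ nat n mod p" "p > 1" "n \<ge> 1"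
  shows "smooth_pow p n t d = d ^ nat n mod p"
  using assms
proof (induction p n t d rule: smooth_pow.induct)
  case (1 p n d)
  then show ?case by (simp add: fast_pow_mod)
next
  case (2 p n l s t d)
  show ?case
  proof (cases "0 < d \<and> 1 < l \<and> l dvd d")
    case True
    have s: "s = l ^ nat n mod p" using "2.prems"(1) by simp
    have "s * smooth_pow p n ((l, s) # t) (d div l) mod p = s * ((d div l) ^ nat n mod p) mod p"
      by (simp only: "2.IH"(1)[OF True "2.prems"])
    also have "\<dots> = l ^ nat n * (d div l) ^ nat n mod p" by (simp only: s mod_mult_eq)
    also have "\<dots> = (l * (d div l)) ^ nat n mod p" by (simp only: power_mult_distrib)
    finally show ?thesis using True by (simp add: smooth_pow.simps(2)[of p n l s t d])
  next
    case False
    have "\<forall>(l, s)\<in>set t. s = l ^ nat n mod p" using "2.prems"(1) by simp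
    then have "smooth_pow p n t d = d ^ nat n mod p" using "2.IH"(2)[OF False] "2.prems"(2,3) by blast
    then show ?thesis by (simp only: smooth_pow.simps(2)[of p n l s t d] if_not_P[OF False])
  qed
qed

lemma pow_table_valid: "n \<ge> 1 \<Longrightarrow> \<forall>(l, s)\<in>set (pow_table p n ls). s = l ^ nat n mod p"
  by (induction ls) (auto simp: fast_pow_mod)

lemma residue_ring_cubic_residue_field:
  assumes "prime p" "p mod 6 = 1"
  shows "cubic_residue_field (residue_ring (int p))" "order (residue_ring (int p)) = p"
proof -
  interpret residues_prime p "residue_ring (int p)" by unfold_locales (use assms in auto)
  show "order (residue_ring (int p)) = p" by (simp add: order_def res_carrier_eq)
  then show "cubic_residue_field (residue_ring (int p))"
    by unfold_locales (use assms in auto)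
qed

lemma prime_field_check_has_rainbow_fano:
  assumes p: "prime p" "p mod 6 = 1" and check: "prime_field_check xs (int p)"
  shows "has_rainbow_fano (carrier (residue_ring (int p))) (difference_symbol (residue_ring (int p)))"
proof -
  interpret residues_prime p "residue_ring (int p)" by unfold_locales (use p in auto)
  let ?R = "residue_ring (int p)"
  define e where "e = (p - 1) div 3"
  define t where "t = pow_table (int p) (int e) [2, 3, 5, 7]"
  have "p \<ge> 7" using p prime_gt_1_nat[OF p(1)] by presburger
  then have e: "(int p - 1) div 3 = int e" "e \<ge> 1" by (auto simp: e_def zdiv_int of_nat_diff)
  have "prime_symbol (int p) (int e) t x y = difference_symbol ?R x y" if "x \<in> carrier ?R" "y \<in> carrier ?R" for x y
  proof -
    have "even e" unfolding e_def using p(2) by presburger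
    have "difference_symbol ?R x y = (x - y) ^ e mod int p"
      by (simp add: difference_symbol_def cubic_symbol_def residue_ring_cubic_residue_field(2)[OF p] e_def
          a_minus_def res_neg_eq res_add_eq pow_cong mod_simps)
    also have "\<dots> = \<bar>x - y\<bar> ^ e mod int p" using \<open>even e\<close> by (simp only: power_even_abs)
    also have "\<dots> = prime_symbol (int p) (int e) t x y"
      unfolding prime_symbol_def t_def
      using smooth_pow_eq[OF pow_table_valid, of "int e" "int p"] \<open>p \<ge> 7\<close> e(2) by (simp del: pow_table.simps)
    finally show ?thesis by simp
  qed
  moreover have "set xs \<subseteq> carrier ?R" "rainbow_points (prime_symbol (int p) (int e) t) xs"
    using check by (auto simp: prime_field_check_def Let_def e t_def list_all_iff res_carrier_eq)
  ultimately show ?thesis by (intro rainbow_points_has_rainbow_fano)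
qed

definition extension_symbol ::
    "('a::ab_group_add \<Rightarrow> 'a) \<Rightarrow> ('a \<Rightarrow> 'a \<Rightarrow> 'a) \<Rightarrow> int \<Rightarrow> 'a \<Rightarrow> 'a \<Rightarrow> 'a" where
  "extension_symbol r m n x y = fast_pow (\<lambda>x y. r (m x y)) (r (x - y)) n"

lemma (in ring_reduction) rainbow_points_extension:
  assumes n: "nat n = (order Q - 1) div 3" "n \<ge> 1"
    and xs: "set xs \<subseteq> carrier Q" "rainbow_points (extension_symbol r m n) xs"
  shows "has_rainbow_fano (carrier Q) (difference_symbol Q)"
proof (rule rainbow_points_has_rainbow_fano[OF xs(1) _ xs(2)])
  interpret cring Q by (rule reduction_ring_cring)
  fix x y assume "x \<in> carrier Q" "y \<in> carrier Q"
  then have diff: "x \<ominus>\<^bsub>Q\<^esub> y = r (x - y)" "r (x - y) \<in> carrier Q"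
    by (simp_all add: reduction_ring_minus reduction_ring_simps)
  have "extension_symbol r m n x y = r (x - y) [^]\<^bsub>Q\<^esub> nat n"
    unfolding extension_symbol_def
  proof (rule fast_pow_eq[OF n(2)])
    show "r (m (r (x - y) [^]\<^bsub>Q\<^esub> i) (r (x - y) [^]\<^bsub>Q\<^esub> j)) = r (x - y) [^]\<^bsub>Q\<^esub> (i + j)" for i j :: nat
      using nat_pow_mult[OF diff(2), of i j] by (simp only: reduction_ring_simps)
  qed (use diff(2) in simp)
  then show "extension_symbol r m n x y = difference_symbol Q x y"
    by (simp only: difference_symbol_def cubic_symbol_def n(1) diff(1))
qed

definition quadratic_check :: "int \<Rightarrow> int \<Rightarrow> (int \<times> int) list \<Rightarrow> bool" where
  "quadratic_check p w xs \<longleftrightarrow> list_all (\<lambda>(a, b). 0 \<le> a \<and> a < p \<and> 0 \<le> b \<and> b < p) xs \<and>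
     rainbow_points (extension_symbol (quad_red p) (quad_mult w) ((p * p - 1) div 3)) xs"

lemma quadratic_check_has_rainbow_fano:
  assumes p: "p > 1" "p * p mod 6 = 1" and check: "quadratic_check (int p) w xs"
  shows "has_rainbow_fano (carrier (quadratic_ring (int p) w)) (difference_symbol (quadratic_ring (int p) w))"
proof (rule quad.rainbow_points_extension)
  define n where "n = (int p * int p - 1) div 3"
  have "p * p \<ge> 4" using mult_le_mono[of 2 p 2 p] p(1) by simp
  moreover have "n = int ((p * p - 1) div 3)"
    using p(1) by (simp add: n_def zdiv_int of_nat_diff)
  ultimately show "nat n = (order (quadratic_ring (int p) w) - 1) div 3" "n \<ge> 1"
    using p(1) quadratic_ring_order[of p w] by auto
  show "set xs \<subseteq> carrier (quadratic_ring (int p) w)" "rainbow_points (extension_symbol (quad_red p) (quad_mult w) n) xs"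
    using check p(1) by (auto simp: quadratic_check_def quadratic_ring_carrier list_all_iff n_def)
qed

definition quadratic_table :: "(int \<times> (int \<times> int) list) list" where
  "quadratic_table = [
    (5, [(0, 0), (0, 1), (1, 0), (1, 2), (0, 2), (3, 3), (3, 4)]),
    (11, [(0, 0), (0, 1), (1, 0), (3, 3), (1, 2), (2, 5), (4, 2)]),
    (17, [(0, 0), (0, 1), (1, 0), (1, 3), (3, 3), (5, 2), (10, 1)]),
    (23, [(0, 0), (0, 1), (1, 0), (3, 3), (1, 2), (0, 5), (4, 3)]),
    (29, [(0, 0), (0, 1), (1, 0), (2, 2), (1, 2), (4, 1), (17, 16)]),
    (41, [(0, 0), (0, 1), (1, 0), (2, 2), (1, 2), (3, 0), (13, 1)]),
    (47, [(0, 0), (0, 1), (1, 0), (1, 2), (0, 2), (4, 1), (7, 10)]),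
    (53, [(0, 0), (0, 1), (1, 0), (4, 2), (4, 4), (2, 1), (14, 6)]),
    (59, [(0, 0), (0, 1), (1, 0), (3, 5), (1, 2), (5, 6), (14, 1)]),
    (71, [(0, 0), (0, 1), (1, 0), (2, 4), (4, 4), (8, 3), (9, 18)])]"

lemma quadratic_table_sound: "list_all (\<lambda>(p, xs). quadratic_check p (-3) xs) quadratic_table"
  by code_simp

lemma quadratic_check_13: "quadratic_check 13 2 [(0, 0), (0, 1), (1, 0), (1, 2), (0, 2), (1, 7), (2, 7)]"
  by code_simp

lemma rainbow_points_2197:
  "rainbow_points (extension_symbol (cub_red 13) (cub_mult 2) 732)
     [(0, 0, 0), (0, 0, 1), (0, 1, 0), (1, 0, 0), (1, 0, 1), (1, 2, 3), (2, 0, 0)]"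
  by code_simp

definition has_small_divisor :: "int \<Rightarrow> bool" where
  "has_small_divisor n \<longleftrightarrow>
     list_ex (\<lambda>d. n mod d = 0 \<and> d < n) [5, 7, 11, 13, 17, 19, 23, 29, 31, 37, 41, 43, 47, 53, 59, 61, 67, 71, 73]"

lemma has_small_divisor_not_prime:
  assumes "has_small_divisor n"
  shows "\<not> prime n"
proof -
  obtain d where "d dvd n" "d < n" "1 < d" using assms unfolding has_small_divisor_def by auto
  then show ?thesis unfolding prime_int_iff by (auto intro!: exI[of _ d])
qed

definition in_prime_field_table :: "int \<Rightarrow> bool" where
  "in_prime_field_table p \<longleftrightarrow> list_ex (\<lambda>(xs, ps). p \<in> set ps) prime_field_table"

lemma prime_field_table_sound:
  "list_all (\<lambda>(xs, ps). list_all (prime_field_check xs) ps) prime_field_table"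
  by code_simp

lemma prime_field_table_complete:
  "list_all (\<lambda>k. k = 2 \<or> has_small_divisor (6 * k + 1) \<or> in_prime_field_table (6 * k + 1)) [1..912]"
  by code_simp

section \<open>Existence of regular Fano Kaleidoscopes\<close>

lemma prime_field_has_rainbow_fano:
  fixes p :: nat
  assumes p: "prime p" "p mod 6 = 1" "p \<noteq> 13"
  shows "has_rainbow_fano (carrier (residue_ring (int p))) (difference_symbol (residue_ring (int p)))"
proof (cases "p < 5476")
  case True
  define k where "k = int p div 6"
  have "int p mod 6 = 1" using p(2) by (metis of_nat_1 of_nat_numeral zmod_int)
  then have pk: "int p = 6 * k + 1" unfolding k_def by presburger
  moreover have "p > 1" using p(1) by (rule prime_gt_1_nat)
  ultimately have "k \<in> set [1..912]" "k \<noteq> 2" using p(3) True by auto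
  moreover have "\<not> has_small_divisor (6 * k + 1)"
    using has_small_divisor_not_prime[of "int p"] p(1) by (metis pk prime_nat_int_transfer)
  ultimately have "in_prime_field_table (int p)"
    using prime_field_table_complete pk unfolding list_all_iff by metis
  then obtain xs ps where "(xs, ps) \<in> set prime_field_table" "int p \<in> set ps"
    unfolding in_prime_field_table_def list_ex_iff by auto
  then have "prime_field_check xs (int p)"
    using prime_field_table_sound unfolding list_all_iff by fast
  then show ?thesis by (rule prime_field_check_has_rainbow_fano[OF p(1,2)])
next
  case False
  then show ?thesis
    using residue_ring_cubic_residue_field[OF p(1,2)]
    by (intro cubic_residue_field.has_rainbow_fano_large) simp_all
qed

lemma mod_6_square: "(p::nat) mod 6 = 1 \<or> p mod 6 = 5 \<Longrightarrow> p * p mod 6 = 1"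
  using mod_mult_eq[of p 6 p] by auto

lemma quadratic_ring_minus_three:
  assumes p: "prime p" "p mod 6 = 5"
  shows "cubic_residue_field (quadratic_ring (int p) (-3))" "order (quadratic_ring (int p) (-3)) = p * p"
  using p mod_6_square anisotropic_mod_minus_three prime_gt_0_nat
  by (auto intro: quadratic_ring_cubic_residue_field quadratic_ring_order)

lemma quadratic_ring_has_rainbow_fano:
  assumes p: "prime p" "p mod 6 = 5"
  defines "R \<equiv> quadratic_ring (int p) (-3)"
  shows "has_rainbow_fano (carrier R) (difference_symbol R)"
proof (cases "p < 74")
  case True
  have "p \<noteq> 35" "p \<noteq> 65" using p(1) by (auto simp: prime_nat_iff dest: spec[of _ 5])
  then have "p \<in> {5, 11, 17, 23, 29, 41, 47, 53, 59, 71}" using True p(2) by simp presburger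
  then have "int p \<in> fst ` set quadratic_table" by (auto simp: quadratic_table_def)
  then obtain xs where "(int p, xs) \<in> set quadratic_table" by auto
  then have "quadratic_check (int p) (-3) xs"
    using quadratic_table_sound unfolding list_all_iff by fast
  then show ?thesis
    unfolding R_def using p mod_6_square prime_gt_1_nat by (intro quadratic_check_has_rainbow_fano) auto
next
  case False
  then have "74 * 74 \<le> p * p" by (intro mult_le_mono) auto
  then show ?thesis
    unfolding R_def
    by (intro cubic_residue_field.has_rainbow_fano_large) (simp_all add: quadratic_ring_minus_three[OF p])
qed

definition admissible_factor :: "nat \<Rightarrow> bool" where
  "admissible_factor q \<longleftrightarrow> (\<forall>v. ex_fano_difference_family v \<longrightarrow> ex_fano_difference_family (v * q))"

lemma admissible_factor_1: "admissible_factor 1"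
  by (simp add: admissible_factor_def)

lemma admissible_factor_mult: "admissible_factor q \<Longrightarrow> admissible_factor r \<Longrightarrow> admissible_factor (q * r)"
  unfolding admissible_factor_def by (metis mult.assoc)

lemma admissible_factor_power: "admissible_factor q \<Longrightarrow> admissible_factor (q ^ n)"
  by (induction n) (simp_all add: admissible_factor_1[simplified] admissible_factor_mult)

lemma admissible_factor_prod: "(\<And>x. x \<in> A \<Longrightarrow> admissible_factor (f x)) \<Longrightarrow> admissible_factor (prod f A)"
  by (induction A rule: infinite_finite_induct)
    (simp_all add: admissible_factor_1[simplified] admissible_factor_mult)

lemma admissible_factor_order:
  assumes "cubic_residue_field R" "has_rainbow_fano (carrier R) (difference_symbol R)"
  shows "admissible_factor (order R)"
proof -
  interpret cubic_residue_field R by fact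
  obtain B where "fano_difference_family (add_monoid R) B"
    using has_rainbow_fano_difference_family[OF assms(2)] by blast
  then show ?thesis
    unfolding admissible_factor_def
    using ex_fano_difference_family_mult[OF _ field_axioms finite_carrier order_ge_7] by blast
qed

lemma admissible_factor_prime:
  assumes "prime p" "p mod 6 = 1" "p \<noteq> 13"
  shows "admissible_factor p"
  using admissible_factor_order prime_field_has_rainbow_fano[OF assms]
    residue_ring_cubic_residue_field[OF assms(1,2)] by metis

lemma admissible_factor_prime_square:
  assumes "prime p" "p mod 6 = 5"
  shows "admissible_factor (p * p)"
  using admissible_factor_order quadratic_ring_has_rainbow_fano[OF assms] quadratic_ring_minus_three[OF assms]
  by metis

lemma admissible_factor_169: "admissible_factor 169"
proof -
  have "cubic_residue_field (quadratic_ring (int 13) 2)"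
    by (rule quadratic_ring_cubic_residue_field) (simp_all add: anisotropic_mod_13)
  moreover have "has_rainbow_fano (carrier (quadratic_ring (int 13) 2)) (difference_symbol (quadratic_ring (int 13) 2))"
    using quadratic_check_13 by (intro quadratic_check_has_rainbow_fano) simp_all
  ultimately have "admissible_factor (order (quadratic_ring (int 13) 2))" by (rule admissible_factor_order)
  then show ?thesis using quadratic_ring_order[of 13 2] by simp
qed

lemma admissible_factor_2197: "admissible_factor 2197"
proof -
  have "has_rainbow_fano (carrier (cubic_ring 13 2)) (difference_symbol (cubic_ring 13 2))"
    by (rule cub.rainbow_points_extension[OF _ _ _ rainbow_points_2197])
      (simp_all add: cubic_ring_13 cubic_ring_carrier)
  then show ?thesis using admissible_factor_order cubic_ring_13 by metis
qed

lemma admissible_factor_13_power: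
  assumes "a \<ge> 2"
  shows "admissible_factor (13 ^ a)"
proof (cases "even a")
  case True
  then obtain k where "a = 2 * k" by blast
  then have "(13::nat) ^ a = 169 ^ k" by (simp add: power_mult)
  then show ?thesis using admissible_factor_power[OF admissible_factor_169] by simp
next
  case False
  then obtain k where "a = 2 * k + 1" using oddE by blast
  then have "a = 3 + 2 * (k - 1)" using assms by simp
  then have "(13::nat) ^ a = 2197 * 169 ^ (k - 1)" by (simp add: power_add power_mult)
  then show ?thesis
    using admissible_factor_mult[OF admissible_factor_2197 admissible_factor_power[OF admissible_factor_169]] by simp
qed

lemma prime_power_mod_6:
  fixes p a :: nat
  assumes "a \<ge> 1" "p ^ a mod 6 = 1"
  obtains (one) "p mod 6 = 1" | (five) "p mod 6 = 5" "even a"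
proof -
  have "\<not> d dvd p" if "d dvd 6" "d > 1" for d
  proof
    assume "d dvd p"
    then have "d dvd p ^ a" using assms(1) by (meson dvd_power dvd_trans less_le_trans zero_less_one)
    then have "d dvd p ^ a mod 6" using \<open>d dvd 6\<close> by (simp add: dvd_mod)
    then show False using assms(2) \<open>d > 1\<close> by simp
  qed
  from this[of 2] this[of 3] have "p mod 6 = 1 \<or> p mod 6 = 5" by simp presburger
  moreover have "even a" if "p mod 6 = 5"
  proof (rule ccontr)
    assume "odd a"
    then obtain k where "a = 2 * k + 1" using oddE by blast
    then have "p ^ a = (p * p) ^ k * p" by (simp add: power_mult power2_eq_square)
    moreover have "(p * p) ^ k mod 6 = 1" using power_mod[of "p * p" 6 k] mod_6_square[of p] that by simp
    ultimately have "p ^ a mod 6 = 5" using that mod_mult_eq[of "(p * p) ^ k" 6 p] by simp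
    then show False using assms(2) by simp
  qed
  ultimately show thesis using that by blast
qed

lemma admissible_factor_prime_power:
  fixes p a :: nat
  assumes p: "prime p" "a \<ge> 1" and mod6: "[p ^ a = 1] (mod 6)" and "p ^ a \<noteq> 13"
  shows "admissible_factor (p ^ a)"
proof -
  have "p ^ a mod 6 = 1" using mod6 by (simp add: cong_def)
  from p(2) this show ?thesis
  proof (cases rule: prime_power_mod_6)
    case one
    show ?thesis
    proof (cases "p = 13")
      case True
      then have "a \<ge> 2" using p(2) \<open>p ^ a \<noteq> 13\<close> by (cases "a = 1") auto
      then show ?thesis using admissible_factor_13_power True by simp
    next
      case False
      then show ?thesis using admissible_factor_power admissible_factor_prime p(1) one by blast
    qed
  next
    case five
    then obtain k where "a = 2 * k" by blast
    then have "p ^ a = (p * p) ^ k" by (simp add: power_mult power2_eq_square)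
    then show ?thesis using admissible_factor_power[OF admissible_factor_prime_square[OF p(1) five(1)]] by simp
  qed
qed

lemma ex_fano_difference_family_1: "ex_fano_difference_family 1"
proof -
  define G :: "nat monoid" where "G = \<lparr>carrier = {0}, monoid.mult = (\<lambda>_ _. 0), one = 0\<rparr>"
  have "comm_group G" by (rule comm_groupI) (auto simp: G_def)
  moreover have "fano_difference_family G {}" by (simp add: fano_difference_family_def G_def)
  moreover have "order G = 1" "finite (carrier G)" by (simp_all add: order_def G_def)
  ultimately show ?thesis unfolding ex_fano_difference_family_def by blast
qed

theorem theorem16:
  fixes v :: nat
  assumes "v > 0"
    and "\<And>p a :: nat. prime p \<Longrightarrow> a \<ge> 1 \<Longrightarrow> p ^ a dvd v \<Longrightarrow> \<not> p ^ (a + 1) dvd v \<Longrightarrow>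
           [p ^ a = 1] (mod 6) \<and> p ^ a \<noteq> 13"
  shows "\<exists>(V :: nat set) F. regular_fano_kaleidoscope v V F"
proof -
  have "admissible_factor (\<Prod>p\<in>prime_factors v. p ^ multiplicity p v)"
  proof (rule admissible_factor_prod)
    fix p assume "p \<in> prime_factors v"
    then have p: "prime p" "multiplicity p v \<ge> 1" by (auto simp: prime_factors_multiplicity)
    have "\<not> p ^ (multiplicity p v + 1) dvd v"
      using p(1) assms(1) by (subst power_dvd_iff_le_multiplicity) auto
    with assms(2)[OF p multiplicity_dvd] show "admissible_factor (p ^ multiplicity p v)"
      by (intro admissible_factor_prime_power p) simp_all
  qed
  then have "admissible_factor v" using assms(1) by (simp add: prime_factorization_nat[symmetric])
  then have "ex_fano_difference_family v"
    using ex_fano_difference_family_1 unfolding admissible_factor_def by fastforce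
  then obtain G :: "nat monoid" and B where "comm_group G" "finite (carrier G)" "order G = v" "fano_difference_family G B"
    unfolding ex_fano_difference_family_def by blast
  then show ?thesis using fano_difference_family_regular by blast
qed

end
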